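(* The group $\mathbb{Z}^2*\mathbb{Z}$ does not embed in R. Thompson's group $V$; that is, there is no injective group homomorphism $\mathbb{Z}^2*\mathbb{Z}\to V$.
   Context: R. Thompson's group $V$: let $\mathcal{T}_2$ be the infinite rooted binary tree with nodes labelled by finite binary strings, and let $\mathfrak{C}=\{0,1\}^{\mathbb{N}}$ be the Cantor set, identified with the infinite descending paths from the root. For a node $n$, $\mathfrak{C}_n\subset\mathfrak{C}$ is the set of infinite strings with prefix $n$. $V$ is the group (under composition) of all homeomorphisms of $\mathfrak{C}$ that can be represented by a triple $(D,R,\sigma)$ where $D$, $R$ are finite rooted binary subtrees of $\mathcal{T}_2$ (containing the root of $\mathcal{T}_2$, each node having $0$ or $2$ children in the subtree) with the same number $k$ of leaves and $\sigma$ is a bijection from the leaves of $D$ to the leaves of $R$; the homeomorphism maps $\mathfrak{C}_i$ onto $\mathfrak{C}_{\sigma(i)}$ for each leaf $i$ of $D$ by the prefix replacement $iw\mapsto \sigma(i)w$. *)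

theory Defs
  imports "HOL-Analysis.Analysis" "HOL-Algebra.Algebra" "HOL-Library.Omega_Words_Fun"
begin

section \<open>Free products of groups\<close>

text \<open>
  The free product of \<open>G\<close> and \<open>H\<close> in its normal-form model.  Its elements are the reduced words:
  finite sequences of non-identity elements taken alternately from \<open>G\<close> (tagged \<open>Inl\<close>) and \<open>H\<close>
  (tagged \<open>Inr\<close>).  Two reduced words are multiplied by concatenating them and reducing at the
  junction.
\<close>

definition reduced_words :: "('a, 'm) monoid_scheme \<Rightarrow> ('b, 'n) monoid_scheme \<Rightarrow> ('a + 'b) list set"
  where "reduced_words G H =
    {ws. set ws \<subseteq> Inl ` (carrier G - {\<one>\<^bsub>G\<^esub>}) \<union> Inr ` (carrier H - {\<one>\<^bsub>H\<^esub>}) \<and>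
         successively (\<lambda>x y. isl x \<noteq> isl y) ws}"

text \<open>Left multiplication of a reduced word by a single non-identity letter.\<close>

fun letter_mult :: "('a, 'm) monoid_scheme \<Rightarrow> ('b, 'n) monoid_scheme \<Rightarrow>
    'a + 'b \<Rightarrow> ('a + 'b) list \<Rightarrow> ('a + 'b) list"
  where
    "letter_mult G H (Inl a) (Inl b # ws) =
       (if a \<otimes>\<^bsub>G\<^esub> b = \<one>\<^bsub>G\<^esub> then ws else Inl (a \<otimes>\<^bsub>G\<^esub> b) # ws)"
  | "letter_mult G H (Inr a) (Inr b # ws) =
       (if a \<otimes>\<^bsub>H\<^esub> b = \<one>\<^bsub>H\<^esub> then ws else Inr (a \<otimes>\<^bsub>H\<^esub> b) # ws)"
  | "letter_mult G H x ws = x # ws"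

definition free_product :: "('a, 'm) monoid_scheme \<Rightarrow> ('b, 'n) monoid_scheme \<Rightarrow> ('a + 'b) list monoid"
  where "free_product G H =
    \<lparr>carrier = reduced_words G H,
     monoid.mult = (\<lambda>us vs. foldr (letter_mult G H) us vs),
     one = []\<rparr>"

definition free_product_inl :: "('a, 'm) monoid_scheme \<Rightarrow> 'a \<Rightarrow> ('a + 'b) list"
  where "free_product_inl G a = (if a = \<one>\<^bsub>G\<^esub> then [] else [Inl a])"

definition free_product_inr :: "('b, 'n) monoid_scheme \<Rightarrow> 'b \<Rightarrow> ('a + 'b) list"
  where "free_product_inr H b = (if b = \<one>\<^bsub>H\<^esub> then [] else [Inr b])"

lemma Nil_reduced [simp]: "[] \<in> reduced_words G H"
  by (simp add: reduced_words_def)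

lemma Cons_reduced:
  "x # ws \<in> reduced_words G H \<longleftrightarrow>
     x \<in> Inl ` (carrier G - {\<one>\<^bsub>G\<^esub>}) \<union> Inr ` (carrier H - {\<one>\<^bsub>H\<^esub>}) \<and>
     ws \<in> reduced_words G H \<and> (ws = [] \<or> isl x \<noteq> isl (hd ws))"
  by (auto simp: reduced_words_def successively_Cons)

context
  fixes G :: "('a, 'm) monoid_scheme" and H :: "('b, 'n) monoid_scheme"
  assumes G: "group G" and H: "group H"
begin

interpretation G: group G by (rule G)
interpretation H: group H by (rule H)

private abbreviation "letters \<equiv> Inl ` (carrier G - {\<one>\<^bsub>G\<^esub>}) \<union> Inr ` (carrier H - {\<one>\<^bsub>H\<^esub>})"

private lemma letter_mult_closed:
  assumes "x \<in> letters" "ws \<in> reduced_words G H"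
  shows "letter_mult G H x ws \<in> reduced_words G H"
  using assms
  by (cases "(G, H, x, ws)" rule: letter_mult.cases) (auto simp: Cons_reduced)

private lemma mult_closed:
  assumes "us \<in> reduced_words G H" "vs \<in> reduced_words G H"
  shows "foldr (letter_mult G H) us vs \<in> reduced_words G H"
  using assms(1)
  by (induction us) (use assms(2) in \<open>auto simp: Cons_reduced intro!: letter_mult_closed\<close>)

private lemma letter_mult_inl:
  assumes "a \<in> carrier G - {\<one>\<^bsub>G\<^esub>}" "b \<in> carrier G - {\<one>\<^bsub>G\<^esub>}" "ws \<in> reduced_words G H"
  shows "letter_mult G H (Inl a) (letter_mult G H (Inl b) ws) =
    (if a \<otimes>\<^bsub>G\<^esub> b = \<one>\<^bsub>G\<^esub> then ws else letter_mult G H (Inl (a \<otimes>\<^bsub>G\<^esub> b)) ws)"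
proof (cases "\<exists>c vs. ws = Inl c # vs")
  case True
  then obtain c vs where ws: "ws = Inl c # vs" by auto
  have c: "c \<in> carrier G" "c \<noteq> \<one>\<^bsub>G\<^esub>" and vs: "vs = [] \<or> \<not> isl (hd vs)"
    using assms ws by (auto simp: Cons_reduced)
  have *: "letter_mult G H (Inl a) vs = Inl a # vs"
    using vs by (cases vs; cases "hd vs") auto
  have bc: "a \<otimes>\<^bsub>G\<^esub> b \<otimes>\<^bsub>G\<^esub> c = a \<otimes>\<^bsub>G\<^esub> (b \<otimes>\<^bsub>G\<^esub> c)"
    using assms c by (simp add: G.m_assoc)
  show ?thesis
  proof (cases "b \<otimes>\<^bsub>G\<^esub> c = \<one>\<^bsub>G\<^esub>")
    case True
    have "a \<otimes>\<^bsub>G\<^esub> b = \<one>\<^bsub>G\<^esub> \<longleftrightarrow> a = c"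
      using True assms c by (metis DiffD1 G.inv_equality G.inv_comm)
    then show ?thesis using True assms c bc ws * by auto
  next
    case False
    then show ?thesis using assms c bc ws * by auto
  qed
next
  case False
  then have "letter_mult G H (Inl d) ws = Inl d # ws" for d
    by (cases "(G, H, Inl d :: 'a + 'b, ws)" rule: letter_mult.cases) auto
  then show ?thesis by simp
qed

private lemma letter_mult_inr:
  assumes "a \<in> carrier H - {\<one>\<^bsub>H\<^esub>}" "b \<in> carrier H - {\<one>\<^bsub>H\<^esub>}" "ws \<in> reduced_words G H"
  shows "letter_mult G H (Inr a) (letter_mult G H (Inr b) ws) =
    (if a \<otimes>\<^bsub>H\<^esub> b = \<one>\<^bsub>H\<^esub> then ws else letter_mult G H (Inr (a \<otimes>\<^bsub>H\<^esub> b)) ws)"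
proof (cases "\<exists>c vs. ws = Inr c # vs")
  case True
  then obtain c vs where ws: "ws = Inr c # vs" by auto
  have c: "c \<in> carrier H" "c \<noteq> \<one>\<^bsub>H\<^esub>" and vs: "vs = [] \<or> isl (hd vs)"
    using assms ws by (auto simp: Cons_reduced)
  have *: "letter_mult G H (Inr a) vs = Inr a # vs"
    using vs by (cases vs; cases "hd vs") auto
  have bc: "a \<otimes>\<^bsub>H\<^esub> b \<otimes>\<^bsub>H\<^esub> c = a \<otimes>\<^bsub>H\<^esub> (b \<otimes>\<^bsub>H\<^esub> c)"
    using assms c by (simp add: H.m_assoc)
  show ?thesis
  proof (cases "b \<otimes>\<^bsub>H\<^esub> c = \<one>\<^bsub>H\<^esub>")
    case True
    have "a \<otimes>\<^bsub>H\<^esub> b = \<one>\<^bsub>H\<^esub> \<longleftrightarrow> a = c"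
      using True assms c by (metis DiffD1 H.inv_equality H.inv_comm)
    then show ?thesis using True assms c bc ws * by auto
  next
    case False
    then show ?thesis using assms c bc ws * by auto
  qed
next
  case False
  then have "letter_mult G H (Inr d) ws = Inr d # ws" for d
    by (cases "(G, H, Inr d :: 'a + 'b, ws)" rule: letter_mult.cases) auto
  then show ?thesis by simp
qed

private lemma letter_mult_mult:
  assumes "x \<in> letters" "ys \<in> reduced_words G H" "ws \<in> reduced_words G H"
  shows "foldr (letter_mult G H) (letter_mult G H x ys) ws =
    letter_mult G H x (foldr (letter_mult G H) ys ws)"
proof -
  consider (ll) a b zs where "x = Inl a" "ys = Inl b # zs"
    | (rr) a b zs where "x = Inr a" "ys = Inr b # zs"
    | (other) "letter_mult G H x ys = x # ys"
    by (cases "(G, H, x, ys)" rule: letter_mult.cases) auto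
  then show ?thesis
  proof cases
    case ll
    then have "foldr (letter_mult G H) zs ws \<in> reduced_words G H"
      using assms by (intro mult_closed) (auto simp: Cons_reduced)
    from letter_mult_inl[OF _ _ this, of a b] show ?thesis
      using ll assms by (auto simp: Cons_reduced)
  next
    case rr
    then have "foldr (letter_mult G H) zs ws \<in> reduced_words G H"
      using assms by (intro mult_closed) (auto simp: Cons_reduced)
    from letter_mult_inr[OF _ _ this, of a b] show ?thesis
      using rr assms by (auto simp: Cons_reduced)
  next
    case other
    then show ?thesis by simp
  qed
qed

private lemma letter_inverse:
  assumes "x \<in> letters"
  shows "\<exists>y\<in>letters. letter_mult G H y [x] = []"
proof -
  from assms consider a where "x = Inl a" "a \<in> carrier G" "a \<noteq> \<one>\<^bsub>G\<^esub>"
    | b where "x = Inr b" "b \<in> carrier H" "b \<noteq> \<one>\<^bsub>H\<^esub>" by auto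
  then show ?thesis
  proof cases
    case 1
    then show ?thesis by (intro bexI[of _ "Inl (inv\<^bsub>G\<^esub> a)"]) (auto simp: G.inv_eq_1_iff)
  next
    case 2
    then show ?thesis by (intro bexI[of _ "Inr (inv\<^bsub>H\<^esub> b)"]) (auto simp: H.inv_eq_1_iff)
  qed
qed

private lemma mult_assoc:
  assumes "us \<in> reduced_words G H" "vs \<in> reduced_words G H" "ws \<in> reduced_words G H"
  shows "foldr (letter_mult G H) (foldr (letter_mult G H) us vs) ws =
    foldr (letter_mult G H) us (foldr (letter_mult G H) vs ws)"
  using assms(1)
proof (induction us)
  case (Cons x us)
  then have "x \<in> letters" "us \<in> reduced_words G H" by (auto simp: Cons_reduced)
  then show ?case using Cons assms by (simp add: letter_mult_mult mult_closed)
qed simp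

private lemma mult_Nil:
  assumes "us \<in> reduced_words G H"
  shows "foldr (letter_mult G H) us [] = us"
  using assms
proof (induction us)
  case (Cons x us)
  then have "foldr (letter_mult G H) us [] = us" by (simp add: Cons_reduced)
  moreover have "letter_mult G H x us = x # us"
    using Cons.prems by (cases "(G, H, x, us)" rule: letter_mult.cases) (auto simp: Cons_reduced)
  ultimately show ?case by simp
qed simp

private lemma mult_inverse:
  assumes "us \<in> reduced_words G H"
  shows "\<exists>vs\<in>reduced_words G H. foldr (letter_mult G H) vs us = []"
  using assms
proof (induction us)
  case (Cons x us)
  then have x: "x \<in> letters" and us: "us \<in> reduced_words G H" by (auto simp: Cons_reduced)
  from Cons.IH[OF us] obtain vs where
    vs: "vs \<in> reduced_words G H" "foldr (letter_mult G H) vs us = []" by blast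
  from letter_inverse[OF x] obtain y where y: "y \<in> letters" "letter_mult G H y [x] = []" by blast
  have sing: "[x] \<in> reduced_words G H" "[y] \<in> reduced_words G H"
    using x y by (auto simp: Cons_reduced)
  have "foldr (letter_mult G H) [x] us = x # us"
    using Cons.prems by (cases "(G, H, x, us)" rule: letter_mult.cases) (auto simp: Cons_reduced)
  then have "foldr (letter_mult G H) [y] (x # us) =
      foldr (letter_mult G H) (foldr (letter_mult G H) [y] [x]) us"
    using mult_assoc[OF sing(2) sing(1) us] by simp
  also have "\<dots> = us" using y by simp
  finally have "foldr (letter_mult G H) (foldr (letter_mult G H) vs [y]) (x # us) = []"
    using mult_assoc[OF vs(1) sing(2) Cons.prems] vs(2) by simp
  then show ?case using mult_closed[OF vs(1) sing(2)] by blast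
qed (auto intro!: bexI[of _ "[]"])

theorem group_free_product: "group (free_product G H)"
proof (rule groupI)
  fix us assume "us \<in> carrier (free_product G H)"
  then show "\<exists>vs\<in>carrier (free_product G H). vs \<otimes>\<^bsub>free_product G H\<^esub> us = \<one>\<^bsub>free_product G H\<^esub>"
    using mult_inverse by (simp add: free_product_def)
qed (auto simp: free_product_def mult_closed mult_assoc)

lemma free_product_inl_hom: "free_product_inl G \<in> hom G (free_product G H)"
  by (rule homI) (auto simp: free_product_inl_def free_product_def Cons_reduced)

lemma free_product_inr_hom: "free_product_inr H \<in> hom H (free_product G H)"
  by (rule homI) (auto simp: free_product_inr_def free_product_def Cons_reduced)

theorem free_product_universal:
  fixes K :: "('c, 'k) monoid_scheme"
  assumes K: "group K" and f: "f \<in> hom G K" and g: "g \<in> hom H K"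
  shows "\<exists>h\<in>hom (free_product G H) K.
      (\<forall>a\<in>carrier G. h (free_product_inl G a) = f a) \<and>
      (\<forall>b\<in>carrier H. h (free_product_inr H b) = g b) \<and>
      (\<forall>h'\<in>hom (free_product G H) K.
         (\<forall>a\<in>carrier G. h' (free_product_inl G a) = f a) \<longrightarrow>
         (\<forall>b\<in>carrier H. h' (free_product_inr H b) = g b) \<longrightarrow>
         (\<forall>w\<in>carrier (free_product G H). h' w = h w))"
proof -
  interpret K: group K by (rule K)
  define v where "v = case_sum f g"
  define h where "h = (\<lambda>ws. foldr (\<lambda>x k. v x \<otimes>\<^bsub>K\<^esub> k) ws \<one>\<^bsub>K\<^esub>)"
  have h_simps [simp]: "h [] = \<one>\<^bsub>K\<^esub>" "h (x # ws) = v x \<otimes>\<^bsub>K\<^esub> h ws" for x ws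
    by (auto simp: h_def)
  have v_closed: "v x \<in> carrier K" if "x \<in> letters" for x
    using that f g by (auto simp: v_def hom_def)
  have h_closed: "h ws \<in> carrier K" if "ws \<in> reduced_words G H" for ws
    using that by (induction ws) (auto simp: Cons_reduced v_closed)
  have f1: "f \<one>\<^bsub>G\<^esub> = \<one>\<^bsub>K\<^esub>" and g1: "g \<one>\<^bsub>H\<^esub> = \<one>\<^bsub>K\<^esub>"
    using hom_one[OF f G K] hom_one[OF g H K] by auto
  have h_letter: "h (letter_mult G H x ws) = v x \<otimes>\<^bsub>K\<^esub> h ws"
    if x: "x \<in> letters" and ws: "ws \<in> reduced_words G H" for x ws
  proof -
    consider (ll) a b zs where "x = Inl a" "ws = Inl b # zs"
      | (rr) a b zs where "x = Inr a" "ws = Inr b # zs"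
      | (other) "letter_mult G H x ws = x # ws"
      by (cases "(G, H, x, ws)" rule: letter_mult.cases) auto
    then show ?thesis
    proof cases
      case ll
      then have ab: "a \<in> carrier G" "b \<in> carrier G" and zs: "h zs \<in> carrier K"
        using x ws h_closed by (auto simp: Cons_reduced)
      have "f a \<in> carrier K" "f b \<in> carrier K" using ab f by (auto simp: hom_def)
      then show ?thesis
        using ll ab zs f1 hom_mult[OF f ab] by (auto simp: v_def K.m_assoc[symmetric])
    next
      case rr
      then have ab: "a \<in> carrier H" "b \<in> carrier H" and zs: "h zs \<in> carrier K"
        using x ws h_closed by (auto simp: Cons_reduced)
      have "g a \<in> carrier K" "g b \<in> carrier K" using ab g by (auto simp: hom_def)
      then show ?thesis
        using rr ab zs g1 hom_mult[OF g ab] by (auto simp: v_def K.m_assoc[symmetric])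
    next
      case other
      then show ?thesis by simp
    qed
  qed
  have h_mult: "h (foldr (letter_mult G H) us ws) = h us \<otimes>\<^bsub>K\<^esub> h ws"
    if "us \<in> reduced_words G H" and ws: "ws \<in> reduced_words G H" for us ws
    using that(1)
  proof (induction us)
    case (Cons x us)
    then have "x \<in> letters" "us \<in> reduced_words G H" by (auto simp: Cons_reduced)
    then show ?case using Cons ws
      by (simp add: h_letter mult_closed v_closed h_closed K.m_assoc)
  qed (simp add: h_closed ws)
  have hom: "h \<in> hom (free_product G H) K"
    by (rule homI) (auto simp: free_product_def h_closed h_mult)
  have hl: "h (free_product_inl G a) = f a" if "a \<in> carrier G" for a
    using that f f1 by (auto simp: free_product_inl_def v_def hom_def Pi_def)
  have hr: "h (free_product_inr H b) = g b" if "b \<in> carrier H" for b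
    using that g g1 by (auto simp: free_product_inr_def v_def hom_def Pi_def)
  have "h' ws = h ws"
    if h': "h' \<in> hom (free_product G H) K"
      and l: "\<forall>a\<in>carrier G. h' (free_product_inl G a) = f a"
      and r: "\<forall>b\<in>carrier H. h' (free_product_inr H b) = g b"
      and ws: "ws \<in> reduced_words G H" for h' ws
    using ws
  proof (induction ws)
    case Nil
    show ?case using hom_one[OF h' group_free_product K] by (simp add: free_product_def)
  next
    case (Cons x ws)
    then have x: "x \<in> letters" and ws: "ws \<in> reduced_words G H" by (auto simp: Cons_reduced)
    have "letter_mult G H x ws = x # ws"
      using Cons.prems by (cases "(G, H, x, ws)" rule: letter_mult.cases) (auto simp: Cons_reduced)
    then have "x # ws = [x] \<otimes>\<^bsub>free_product G H\<^esub> ws" by (simp add: free_product_def)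
    moreover have "[x] \<in> carrier (free_product G H)" "ws \<in> carrier (free_product G H)"
      using x ws by (auto simp: free_product_def Cons_reduced)
    ultimately have "h' (x # ws) = h' [x] \<otimes>\<^bsub>K\<^esub> h' ws" using hom_mult[OF h'] by metis
    moreover have "h' [x] = v x"
    proof -
      have "h' [Inl a] = f a" if "a \<in> carrier G" "a \<noteq> \<one>\<^bsub>G\<^esub>" for a
        using bspec[OF l that(1)] that(2) by (simp add: free_product_inl_def)
      moreover have "h' [Inr b] = g b" if "b \<in> carrier H" "b \<noteq> \<one>\<^bsub>H\<^esub>" for b
        using bspec[OF r that(1)] that(2) by (simp add: free_product_inr_def)
      ultimately show ?thesis using x by (elim UnE imageE) (simp_all add: v_def)
    qed
    ultimately show ?case using Cons.IH[OF ws] by simp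
  qed
  then have "\<forall>h'\<in>hom (free_product G H) K.
      (\<forall>a\<in>carrier G. h' (free_product_inl G a) = f a) \<longrightarrow>
      (\<forall>b\<in>carrier H. h' (free_product_inr H b) = g b) \<longrightarrow>
      (\<forall>w\<in>carrier (free_product G H). h' w = h w)"
    by (simp add: free_product_def)
  with hom hl hr show ?thesis by blast
qed

end


section \<open>Thompson's group V\<close>

text \<open>
  Nodes of the infinite rooted binary tree are finite binary strings (\<open>bool list\<close>); the root is
  \<open>[]\<close> and the children of \<open>n\<close> are \<open>n @ [False]\<close> and \<open>n @ [True]\<close>.  The Cantor set is the type
  \<open>nat \<Rightarrow> bool\<close> with its product topology (\<open>bool\<close> being discrete), and \<open>n \<frown> w\<close> is the infinite
  string with prefix \<open>n\<close> and tail \<open>w\<close>.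
\<close>

definition finite_subtree :: "bool list set \<Rightarrow> bool"
  where "finite_subtree T \<longleftrightarrow>
    finite T \<and> [] \<in> T \<and>
    (\<forall>n b. n @ [b] \<in> T \<longrightarrow> n \<in> T) \<and>
    (\<forall>n\<in>T. n @ [False] \<in> T \<longleftrightarrow> n @ [True] \<in> T)"

definition leaves :: "bool list set \<Rightarrow> bool list set"
  where "leaves T = {n \<in> T. \<forall>b. n @ [b] \<notin> T}"

definition represents ::
    "bool list set \<Rightarrow> bool list set \<Rightarrow> (bool list \<Rightarrow> bool list) \<Rightarrow> (bool word \<Rightarrow> bool word) \<Rightarrow> bool"
  where "represents D R \<sigma> f \<longleftrightarrow>
    finite_subtree D \<and> finite_subtree R \<and> bij_betw \<sigma> (leaves D) (leaves R) \<and>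
    (\<forall>n\<in>leaves D. \<forall>w. f (n \<frown> w) = \<sigma> n \<frown> w)"

definition thompson_V :: "(bool word \<Rightarrow> bool word) monoid"
  where "thompson_V =
    \<lparr>carrier = {f. (\<exists>g. homeomorphism UNIV UNIV f g) \<and> (\<exists>D R \<sigma>. represents D R \<sigma> f)},
     monoid.mult = (\<circ>),
     one = id\<rparr>"

lemma finite_subtree_child_iff:
  assumes "finite_subtree T"
  shows "n @ [b] \<in> T \<longleftrightarrow> n @ [c] \<in> T"
  using assms by (cases b; cases c) (auto simp: finite_subtree_def)

lemma finite_subtree_Un:
  assumes "finite_subtree S" "finite_subtree T"
  shows "finite_subtree (S \<union> T)"
  using assms finite_subtree_child_iff[OF assms(1)] finite_subtree_child_iff[OF assms(2)]
  unfolding finite_subtree_def by blast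

lemma finite_subtree_add_caret:
  assumes T: "finite_subtree T" and n: "n \<in> leaves T"
  shows "finite_subtree (T \<union> {n @ [False], n @ [True]})"
    and "leaves (T \<union> {n @ [False], n @ [True]}) = (leaves T - {n}) \<union> {n @ [False], n @ [True]}"
proof -
  have nT: "n \<in> T" and nb: "n @ [b] \<notin> T" for b using n by (auto simp: leaves_def)
  have pre: "m \<in> T" if "m @ [b] \<in> T" for m b using T that by (auto simp: finite_subtree_def)
  have nbc: "n @ [b, c] \<notin> T" for b c using pre[of "n @ [b]" c] nb by auto
  show "finite_subtree (T \<union> {n @ [False], n @ [True]})"
    using T nT nb nbc by (auto simp: finite_subtree_def)
  show "leaves (T \<union> {n @ [False], n @ [True]}) = (leaves T - {n}) \<union> {n @ [False], n @ [True]}"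
    using nT nb nbc by (auto simp: leaves_def)
qed

lemma represents_add_caret:
  assumes rep: "represents D R \<sigma> f" and n: "n \<in> leaves D"
  shows "\<exists>R' \<sigma>'. represents (D \<union> {n @ [False], n @ [True]}) R' \<sigma>' f"
proof -
  have D: "finite_subtree D" and R: "finite_subtree R" and bij: "bij_betw \<sigma> (leaves D) (leaves R)"
    and f: "\<And>n w. n \<in> leaves D \<Longrightarrow> f (n \<frown> w) = \<sigma> n \<frown> w"
    using rep by (auto simp: represents_def)
  have sn: "\<sigma> n \<in> leaves R" using bij n by (auto simp: bij_betw_def)
  define \<sigma>' where "\<sigma>' = (\<lambda>m. if m = n @ [False] then \<sigma> n @ [False]
    else if m = n @ [True] then \<sigma> n @ [True] else \<sigma> m)"
  have notl: "n @ [b] \<notin> leaves D" "\<sigma> n @ [b] \<notin> leaves R" for b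
    using n sn by (auto simp: leaves_def)
  have "bij_betw \<sigma> (leaves D - {n}) (leaves R - {\<sigma> n})"
    using bij n by (auto simp: bij_betw_def inj_on_def)
  moreover have "\<sigma>' m = \<sigma> m" if "m \<in> leaves D - {n}" for m
    using that notl by (auto simp: \<sigma>'_def)
  ultimately have "bij_betw \<sigma>' (leaves D - {n}) (leaves R - {\<sigma> n})"
    using bij_betw_cong by blast
  moreover have "bij_betw \<sigma>' {n @ [False], n @ [True]} {\<sigma> n @ [False], \<sigma> n @ [True]}"
    by (auto simp: \<sigma>'_def bij_betw_def)
  ultimately have "bij_betw \<sigma>' ((leaves D - {n}) \<union> {n @ [False], n @ [True]})
      ((leaves R - {\<sigma> n}) \<union> {\<sigma> n @ [False], \<sigma> n @ [True]})"
    by (rule bij_betw_combine) (use notl in auto)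
  moreover have "f (m \<frown> w) = \<sigma>' m \<frown> w"
    if "m \<in> (leaves D - {n}) \<union> {n @ [False], n @ [True]}" for m w
  proof -
    have "f ((n @ [b]) \<frown> w) = (\<sigma> n @ [b]) \<frown> w" for b
      using f[OF n, of "[b] \<frown> w"] by simp
    then show ?thesis using that f notl by (auto simp: \<sigma>'_def)
  qed
  ultimately have "represents (D \<union> {n @ [False], n @ [True]})
      (R \<union> {\<sigma> n @ [False], \<sigma> n @ [True]}) \<sigma>' f"
    using finite_subtree_add_caret[OF D n] finite_subtree_add_caret[OF R sn]
    by (simp add: represents_def)
  then show ?thesis by blast
qed

lemma represents_expand:
  assumes "represents D R \<sigma> f" "finite_subtree E" "D \<subseteq> E"
  shows "\<exists>R' \<sigma>'. represents E R' \<sigma>' f"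
  using assms(1,3)
proof (induction "card (E - D)" arbitrary: D R \<sigma> rule: less_induct)
  case less
  have finE: "finite E" using assms(2) by (simp add: finite_subtree_def)
  have D: "finite_subtree D" using less.prems by (simp add: represents_def)
  show ?case
  proof (cases "D = E")
    case False
    then obtain e where "e \<in> E" "e \<notin> D" using less.prems by auto
    then have "\<exists>n b. n \<in> D \<and> n @ [b] \<in> E \<and> n @ [b] \<notin> D"
    proof (induction e rule: rev_induct)
      case Nil
      then show ?case using D by (simp add: finite_subtree_def)
    next
      case (snoc b n)
      then show ?case using assms(2) unfolding finite_subtree_def by blast
    qed
    then obtain n b where n: "n \<in> D" "n @ [b] \<in> E" "n @ [b] \<notin> D" by blast
    have nl: "n \<in> leaves D" using n finite_subtree_child_iff[OF D] by (auto simp: leaves_def)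
    have sub: "D \<union> {n @ [False], n @ [True]} \<subseteq> E"
      using n less.prems finite_subtree_child_iff[OF assms(2)] by auto
    from represents_add_caret[OF less.prems(1) nl] obtain R' \<sigma>' where
      rep: "represents (D \<union> {n @ [False], n @ [True]}) R' \<sigma>' f" by blast
    have "card (E - (D \<union> {n @ [False], n @ [True]})) < card (E - D)"
      using finE n by (intro psubset_card_mono) (cases b; auto)+
    from less.hyps[OF this rep sub] show ?thesis .
  qed (use less.prems in blast)
qed

lemma represents_inverse:
  assumes "represents D R \<sigma> f" and gf: "\<And>x. g (f x) = x"
  shows "represents R D (inv_into (leaves D) \<sigma>) g"
proof -
  have bij: "bij_betw \<sigma> (leaves D) (leaves R)"
    and f: "\<And>n w. n \<in> leaves D \<Longrightarrow> f (n \<frown> w) = \<sigma> n \<frown> w"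
    using assms by (auto simp: represents_def)
  have "g (m \<frown> w) = inv_into (leaves D) \<sigma> m \<frown> w" if "m \<in> leaves R" for m w
  proof -
    let ?n = "inv_into (leaves D) \<sigma> m"
    have "?n \<in> leaves D" "\<sigma> ?n = m"
      using bij that by (auto simp: bij_betw_def inv_into_into f_inv_into_f)
    then have "f (?n \<frown> w) = m \<frown> w" using f by metis
    then show ?thesis using gf by metis
  qed
  then show ?thesis
    using assms bij_betw_inv_into[OF bij] by (auto simp: represents_def)
qed

lemma represents_comp:
  assumes f: "represents D R \<sigma> f" and g: "represents D' R' \<tau> g"
    and g': "\<And>x. g' (g x) = x" "\<And>x. g (g' x) = x"
  shows "\<exists>A B \<rho>. represents A B \<rho> (f \<circ> g)"
proof -
  have rg': "represents R' D' (inv_into (leaves D') \<tau>) g'"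
    by (rule represents_inverse[OF g g'(1)])
  have E: "finite_subtree (D \<union> R')"
    using f g by (auto simp: represents_def intro: finite_subtree_Un)
  obtain B \<sigma>2 where B: "represents (D \<union> R') B \<sigma>2 f" using represents_expand[OF f E] by blast
  obtain A \<tau>2 where A: "represents (D \<union> R') A \<tau>2 g'" using represents_expand[OF rg' E] by blast
  define \<tau>3 where "\<tau>3 = inv_into (leaves (D \<union> R')) \<tau>2"
  have A': "represents A (D \<union> R') \<tau>3 g"
    unfolding \<tau>3_def by (rule represents_inverse[OF A g'(2)])
  have "(f \<circ> g) (n \<frown> w) = (\<sigma>2 \<circ> \<tau>3) n \<frown> w" if "n \<in> leaves A" for n w
  proof -
    have "\<tau>3 n \<in> leaves (D \<union> R')" using A' that by (auto simp: represents_def bij_betw_def)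
    then show ?thesis using A' B that by (simp add: represents_def)
  qed
  moreover have "bij_betw (\<sigma>2 \<circ> \<tau>3) (leaves A) (leaves B)"
    using A' B by (auto simp: represents_def intro: bij_betw_trans)
  ultimately have "represents A B (\<sigma>2 \<circ> \<tau>3) (f \<circ> g)"
    using A' B by (simp add: represents_def)
  then show ?thesis by blast
qed

theorem group_thompson_V: "group thompson_V"
proof (rule groupI)
  have "represents {[]} {[]} id id"
    by (auto simp: represents_def finite_subtree_def)
  moreover have "homeomorphism UNIV UNIV (id :: bool word \<Rightarrow> bool word) id"
    by (simp add: homeomorphism_def)
  ultimately show "\<one>\<^bsub>thompson_V\<^esub> \<in> carrier thompson_V"
    by (auto simp: thompson_V_def)
next
  fix f g assume "f \<in> carrier thompson_V" "g \<in> carrier thompson_V"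
  then obtain f' D R \<sigma> g' D' R' \<tau> where
    f: "homeomorphism UNIV UNIV f f'" "represents D R \<sigma> f" and
    g: "homeomorphism UNIV UNIV g g'" "represents D' R' \<tau> g"
    by (auto simp: thompson_V_def)
  have "\<exists>A B \<rho>. represents A B \<rho> (f \<circ> g)"
    using represents_comp[OF f(2) g(2), of g'] g(1) by (auto simp: homeomorphism_def)
  with homeomorphism_compose[OF g(1) f(1)]
  show "f \<otimes>\<^bsub>thompson_V\<^esub> g \<in> carrier thompson_V" by (auto simp: thompson_V_def)
next
  fix f assume "f \<in> carrier thompson_V"
  then obtain f' D R \<sigma> where
    f: "homeomorphism UNIV UNIV f f'" "represents D R \<sigma> f"
    by (auto simp: thompson_V_def)
  have "represents R D (inv_into (leaves D) \<sigma>) f'"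
    using represents_inverse[OF f(2)] f(1) by (auto simp: homeomorphism_def)
  then have "f' \<in> carrier thompson_V"
    using homeomorphism_symD[OF f(1)] by (auto simp: thompson_V_def)
  moreover have "f' \<circ> f = id" using f(1) by (auto simp: homeomorphism_def)
  ultimately show "\<exists>g\<in>carrier thompson_V. g \<otimes>\<^bsub>thompson_V\<^esub> f = \<one>\<^bsub>thompson_V\<^esub>"
    by (auto simp: thompson_V_def)
qed (auto simp: thompson_V_def o_assoc)

end

theory Submission
  imports Defs
begin

text \<open>
  Let \<open>a, b\<close> generate the factor \<open>Z\<^sup>2\<close>.  Some power \<open>\<alpha>\<close> of \<open>a\<close> has a finite set \<open>F\<close> of fixed points
  at which its germ is nontrivial, and every point outside \<open>F\<close> either has a neighbourhood fixed
  pointwise by \<open>\<alpha>\<close> or is attracted to \<open>F\<close>.  Germs in \<open>V\<close> at a common fixed point are classified by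
  an integer, so they commute, and an attracted point is stabilized by a nontrivial element of \<open>Z\<^sup>2\<close>;
  hence every point is.  Replacing \<open>k\<close> repeatedly by a conjugate \<open>k\<^sup>-\<^sup>1\<beta>k\<close>, with \<open>\<beta> \<in> Z\<^sup>2\<close> stabilizing
  \<open>k p\<close> for a point \<open>p \<in> F\<close>, one finds \<open>k \<notin> Z\<^sup>2\<close> that fixes \<open>F\<close> pointwise.  With \<open>g = k\<alpha>k\<^sup>-\<^sup>1\<close>,
  the element \<open>u = \<alpha>g\<^sup>-\<^sup>1\<close> is trivial near \<open>F\<close>, while \<open>h = \<alpha>\<^sup>ng\<^sup>m\<close> for suitable large \<open>n, m\<close> moves
  the support of \<open>u\<close> into the region near \<open>F\<close> where \<open>u\<close> is trivial.  So \<open>u\<close> commutes with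
  \<open>h\<^sup>-\<^sup>1uh\<close>, which contradicts the normal form in the free product.
\<close>

section \<open>Local form of the elements of \<open>V\<close>\<close>

text \<open>The target word is not a parameter: it has to be the prefix of \<open>f y\<close> of
  length \<open>m\<close>, so two lengths describe the replacement at \<open>y\<close>.\<close>

definition local_form :: "(bool word \<Rightarrow> bool word) \<Rightarrow> bool word \<Rightarrow> nat \<Rightarrow> nat \<Rightarrow> bool"
  where "local_form f y l m \<longleftrightarrow> (\<forall>w. f (prefix l y \<frown> w) = prefix m (f y) \<frown> w)"

lemma prefix_le_eq:
  assumes "prefix l x = prefix l y" "k \<le> l"
  shows "prefix k x = prefix k y"
  using arg_cong[OF assms(1), of "take k"] assms(2) by (simp add: min_def)

lemma prefix_eqI: "(\<And>k. prefix k x = prefix k y) \<Longrightarrow> x = y"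
proof
  fix i assume "\<And>k. prefix k x = prefix k y"
  then have "prefix (Suc i) x ! i = prefix (Suc i) y ! i" by metis
  then show "x i = y i" by (simp del: subseq_to_Suc)
qed

lemma prefix_eq_conc: "prefix l x = prefix l y \<Longrightarrow> x = prefix l y \<frown> suffix l x"
  by (metis prefix_suffix)

lemma local_formD:
  assumes "local_form f y l m" "prefix l x = prefix l y"
  shows "f x = prefix m (f y) \<frown> suffix l x"
  using assms by (metis local_form_def prefix_suffix)

text \<open>The next \<open>j\<close> letters of \<open>y\<close> can be moved from the tail into
  both prefixes. This keeps \<open>m - l\<close> and is how lengths are matched before
  composing.\<close>

lemma local_form_shift:
  assumes "local_form f y l m"
  shows "local_form f y (l + j) (m + j)"
proof -
  have *: "f (prefix (l + j) y \<frown> w) = (prefix m (f y) @ subsequence y l (l + j)) \<frown> w" for w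
  proof -
    have "f (prefix (l + j) y \<frown> w) = f (prefix l y \<frown> subsequence y l (l + j) \<frown> w)"
      by (simp add: subsequence_append)
    also have "\<dots> = prefix m (f y) \<frown> subsequence y l (l + j) \<frown> w"
      using assms unfolding local_form_def by blast
    finally show ?thesis by simp
  qed
  have "f y = (prefix m (f y) @ subsequence y l (l + j)) \<frown> suffix (l + j) y"
    using *[of "suffix (l + j) y"] by (metis prefix_suffix)
  then have "prefix (m + j) (f y) = prefix m (f y) @ subsequence y l (l + j)"
    by (metis (no_types, lifting) add_diff_cancel_left' diff_zero length_append prefix_conc_length
        subsequence_length)
  then show ?thesis using * by (simp add: local_form_def)
qed

lemma local_form_comp:
  assumes "local_form g y l m" "local_form f (g y) m n"
  shows "local_form (f \<circ> g) y l n"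
  using assms by (simp add: local_form_def)

lemma local_form_inverse:
  assumes "local_form f y l m" "\<And>x. g (f x) = x"
  shows "local_form g (f y) m l"
  using assms by (metis local_form_def)

section \<open>Prefix replacement at one depth for all points\<close>

definition depth_form :: "(bool word \<Rightarrow> bool word) \<Rightarrow> nat \<Rightarrow> (bool list \<Rightarrow> bool list) \<Rightarrow> bool"
  where "depth_form f L \<sigma> \<longleftrightarrow> (\<forall>v w. length v = L \<longrightarrow> f (v \<frown> w) = \<sigma> v \<frown> w)"

text \<open>The longest prefix of \<open>v\<close> in \<open>D\<close> is such a leaf:
  \<open>v\<close> is longer than every node of \<open>D\<close>, so it continues past this prefix
  to a node outside \<open>D\<close>, whose sibling is then outside \<open>D\<close> as
  well.\<close>

lemma ex_leaf_prefix:
  assumes D: "finite_subtree D" and L: "\<And>n. n \<in> D \<Longrightarrow> length n \<le> L" and v: "L < length v"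
  shows "\<exists>n\<in>leaves D. \<exists>r. v = n @ r"
proof -
  let ?K = "{k. k \<le> length v \<and> take k v \<in> D}"
  have fin: "finite ?K" by simp
  have "0 \<in> ?K" using D by (simp add: finite_subtree_def)
  define k where "k = Max ?K"
  have k: "k \<le> length v" "take k v \<in> D" using Max_in[OF fin] \<open>0 \<in> ?K\<close> unfolding k_def by blast+
  have kL: "k < length v" using L[OF k(2)] v k(1) by simp
  have "Suc k \<notin> ?K" using Max_ge[OF fin, of "Suc k"] unfolding k_def by (metis Suc_n_not_le_n)
  then have "take k v @ [v ! k] \<notin> D" using kL by (simp add: take_Suc_conv_app_nth)
  then have "take k v \<in> leaves D"
    using k finite_subtree_child_iff[OF D] by (auto simp: leaves_def)
  moreover have "v = take k v @ drop k v" by simp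
  ultimately show ?thesis by metis
qed

lemma thompson_V_depth_form:
  assumes "f \<in> carrier thompson_V"
  shows "\<exists>L \<sigma>. L > 0 \<and> depth_form f L \<sigma>"
proof -
  obtain D R \<sigma> where D: "finite_subtree D" and f: "\<And>n w. n \<in> leaves D \<Longrightarrow> f (n \<frown> w) = \<sigma> n \<frown> w"
    using assms by (auto simp: thompson_V_def represents_def)
  define L where "L = Max (length ` D)"
  have L: "length n \<le> L" if "n \<in> D" for n
    using D that by (auto simp: L_def finite_subtree_def)
  have "\<exists>z. \<forall>w. f (v \<frown> w) = z \<frown> w" if v: "length v = Suc L" for v
  proof -
    obtain n r where n: "n \<in> leaves D" "v = n @ r"
      using ex_leaf_prefix[OF D L, of v] v by auto
    then have "f (v \<frown> w) = (\<sigma> n @ r) \<frown> w" for w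
      using f[OF n(1), of "r \<frown> w"] by simp
    then show ?thesis by blast
  qed
  then obtain \<tau> where "\<And>v w. length v = Suc L \<Longrightarrow> f (v \<frown> w) = \<tau> v \<frown> w" by metis
  then have "depth_form f (Suc L) \<tau>" by (simp add: depth_form_def)
  then show ?thesis by blast
qed

lemma thompson_V_local_form:
  assumes "f \<in> carrier thompson_V"
  shows "\<exists>l m. local_form f y l m"
proof -
  obtain L \<sigma> where "depth_form f L \<sigma>" using thompson_V_depth_form[OF assms] by blast
  then have *: "f (prefix L y \<frown> w) = \<sigma> (prefix L y) \<frown> w" for w
    by (simp add: depth_form_def)
  from *[of "suffix L y"] have "prefix (length (\<sigma> (prefix L y))) (f y) = \<sigma> (prefix L y)"
    by (metis prefix_conc_length prefix_suffix)
  then have "local_form f y L (length (\<sigma> (prefix L y)))" using * by (simp add: local_form_def)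
  then show ?thesis by blast
qed

lemma thompson_V_local_form_ge:
  assumes "f \<in> carrier thompson_V"
  shows "\<exists>l m. l \<ge> k \<and> m \<ge> k \<and> local_form f y l m"
proof -
  obtain l m where "local_form f y l m" using thompson_V_local_form[OF assms] by blast
  from local_form_shift[OF this, of k] show ?thesis by (metis le_add2)
qed

lemma thompson_V_continuous:
  assumes "f \<in> carrier thompson_V"
  shows "\<exists>l. \<forall>x. prefix l x = prefix l y \<longrightarrow> prefix k (f x) = prefix k (f y)"
proof -
  obtain l m where lm: "m \<ge> k" "local_form f y l m"
    using thompson_V_local_form_ge[OF assms] by blast
  have "prefix k (f x) = prefix k (f y)" if "prefix l x = prefix l y" for x
    using local_formD[OF lm(2) that] lm(1) by (simp add: min_def)
  then show ?thesis by blast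
qed

lemma thompson_V_bij: "f \<in> carrier thompson_V \<Longrightarrow> bij f"
  unfolding thompson_V_def homeomorphism_def by (auto intro!: o_bij simp: fun_eq_iff)

section \<open>Compactness of the Cantor set\<close>

text \<open>Compactness as Koenig's lemma: a node without a uniform bound below it has a child of
  the same kind, and following such children gives an infinite path that never meets
  \<open>P\<close>.\<close>

lemma fan:
  assumes mono: "\<And>v u. P v \<Longrightarrow> P (v @ u)"
    and bar: "\<And>y :: bool word. \<exists>l. P (prefix l y)"
  shows "\<exists>l. \<forall>v. length v = l \<longrightarrow> P v"
proof (rule ccontr)
  define B where "B v \<longleftrightarrow> (\<exists>l. \<forall>u. length u = l \<longrightarrow> P (v @ u))" for v
  assume "\<not> ?thesis"
  then have nB: "\<not> B []" by (simp add: B_def)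
  have step: "B v" if "B (v @ [False])" "B (v @ [True])" for v
  proof -
    obtain k l where kl: "\<And>u. length u = k \<Longrightarrow> P (v @ [False] @ u)"
      "\<And>u. length u = l \<Longrightarrow> P (v @ [True] @ u)"
      using \<open>B (v @ [False])\<close> \<open>B (v @ [True])\<close> by (auto simp: B_def)
    have "P (v @ u)" if u: "length u = Suc (k + l)" for u
    proof -
      obtain b u' where bu: "u = b # u'" "length u' = k + l" using u by (cases u) auto
      have "P (v @ [False] @ take k u' @ drop k u')" "P (v @ [True] @ take l u' @ drop l u')"
        using mono[OF kl(1)[of "take k u'"], of "drop k u'"]
          mono[OF kl(2)[of "take l u'"], of "drop l u'"] bu by auto
      then show ?thesis using bu by (cases b) auto
    qed
    then show ?thesis unfolding B_def by blast
  qed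
  \<comment> \<open>The path turns right exactly when the left child satisfies \<open>B\<close>; by
    \<open>step\<close> the right child then does not, as long as the current node does not.\<close>
  define path where "path = rec_nat [] (\<lambda>_ v. v @ [B (v @ [False])])"
  have path: "path 0 = []" "path (Suc n) = path n @ [B (path n @ [False])]" for n
    by (simp_all add: path_def)
  have notB: "\<not> B (path n)" for n
  proof (induction n)
    case (Suc n)
    then show ?case using step[of "path n"] by (cases "B (path n @ [False])") (auto simp: path)
  qed (simp add: path nB)
  define y where "y n = B (path n @ [False])" for n
  have "prefix n y = path n" for n
    by (induction n) (simp_all add: path y_def)
  then obtain l where "P (path l)" using bar[of y] by auto
  then have "B (path l)" unfolding B_def by (intro exI[of _ 0]) simp
  with notB show False by blast
qed

section \<open>Orbits under a single element\<close>

text \<open>This follows \<open>f\<close> on a cylinder while the prefix still has the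
  \<open>L\<close> letters that \<open>\<sigma>\<close> reads. A shorter word stays as it is, which
  records that the prefix has died.\<close>

definition prefix_step :: "nat \<Rightarrow> (bool list \<Rightarrow> bool list) \<Rightarrow> bool list \<Rightarrow> bool list"
  where "prefix_step L \<sigma> v = (if length v < L then v else \<sigma> (take L v) @ drop L v)"

lemma prefix_step_run:
  assumes "depth_form f L \<sigma>" "\<And>i. i < n \<Longrightarrow> L \<le> length ((prefix_step L \<sigma> ^^ i) v)"
  shows "(f ^^ n) (v \<frown> w) = (prefix_step L \<sigma> ^^ n) v \<frown> w"
  using assms(2)
proof (induction n)
  case (Suc n)
  let ?v = "(prefix_step L \<sigma> ^^ n) v"
  have L: "L \<le> length ?v" and IH: "(f ^^ n) (v \<frown> w) = ?v \<frown> w"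
    using Suc by auto
  have "f (take L ?v \<frown> drop L ?v \<frown> w) = \<sigma> (take L ?v) \<frown> drop L ?v \<frown> w"
    using assms(1) L unfolding depth_form_def by (metis length_take min.absorb2)
  then have "f (?v \<frown> w) = prefix_step L \<sigma> ?v \<frown> w"
    using L by (simp add: prefix_step_def)
  then show ?case using IH by simp
qed simp

lemma prefix_step_append:
  assumes "\<And>i. i < n \<Longrightarrow> L \<le> length ((prefix_step L \<sigma> ^^ i) v)"
  shows "(prefix_step L \<sigma> ^^ n) (v @ u) = (prefix_step L \<sigma> ^^ n) v @ u"
  using assms
proof (induction n)
  case (Suc n)
  have "L \<le> length ((prefix_step L \<sigma> ^^ n) v)" using Suc.prems by auto
  then have "prefix_step L \<sigma> ((prefix_step L \<sigma> ^^ n) v @ u) = prefix_step L \<sigma> ((prefix_step L \<sigma> ^^ n) v) @ u"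
    by (simp add: prefix_step_def)
  then show ?case using Suc by simp
qed simp

text \<open>Each step loses at most \<open>L\<close> letters, so long prefixes die late.\<close>

lemma prefix_step_length: "length v \<le> length ((prefix_step L \<sigma> ^^ n) v) + n * L"
proof (induction n)
  case (Suc n)
  then show ?case by (auto simp: prefix_step_def)
qed simp

text \<open>On every tail of the natural numbers, a point where \<open>h\<close> is least is such a
  time.\<close>

lemma infinite_records:
  fixes h :: "nat \<Rightarrow> nat"
  shows "infinite {n. \<forall>n'\<ge>n. h n \<le> h n'}"
  unfolding infinite_nat_iff_unbounded_le
proof
  fix n0
  obtain n where "n \<ge> n0" "\<And>n'. n' \<ge> n0 \<Longrightarrow> h n \<le> h n'"
    using ex_has_least_nat[of "\<lambda>n. n \<ge> n0" n0 h] by auto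
  then show "\<exists>n\<ge>n0. n \<in> {n. \<forall>n'\<ge>n. h n \<le> h n'}" by (intro exI[of _ n]) auto
qed

text \<open>
  At a time after which the image of the prefix never becomes shorter, only the first \<open>L\<close> letters
  are ever rewritten.
\<close>

lemma surviving_prefix_attracted:
  assumes f: "depth_form f L \<sigma>"
    and alive: "\<And>n. L \<le> length ((prefix_step L \<sigma> ^^ n) (prefix l y))"
  shows "\<exists>N s x m u. length s = L \<and> (f ^^ N) y = s \<frown> x \<and> m > 0 \<and>
    (\<forall>w. (f ^^ m) (s \<frown> w) = (s @ u) \<frown> w)"
proof -
  let ?st = "prefix_step L \<sigma>"
  define v where "v n = (?st ^^ n) (prefix l y)" for n
  define R where "R = {n. \<forall>n'\<ge>n. length (v n) \<le> length (v n')}"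
  \<comment> \<open>Only finitely many words can stand in the first \<open>L\<close> places, so one
    of them recurs at infinitely many of these times.\<close>
  have "infinite R" unfolding R_def by (rule infinite_records)
  moreover have "finite ((\<lambda>n. take L (v n)) ` R)"
    by (rule finite_subset[OF _ finite_lists_length_le[of UNIV L]]) auto
  ultimately have "\<exists>i\<in>R. infinite {j \<in> R. take L (v j) = take L (v i)}"
    by (rule pigeonhole_infinite)
  then obtain i where i: "i \<in> R" "infinite {j \<in> R. take L (v j) = take L (v i)}" ..
  then obtain j where j: "j > i" "take L (v j) = take L (v i)"
    by (auto simp: infinite_nat_iff_unbounded)
  define s t where "s = take L (v i)" and "t = drop L (v i)"
  have vi: "v i = s @ t" and s: "length s = L" using alive[of i] by (auto simp: s_def t_def v_def)
  have v_add: "v (i + m) = (?st ^^ m) (v i)" for m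
    unfolding v_def by (simp add: add.commute[of i] funpow_add)
  \<comment> \<open>As long as the image of \<open>s\<close> has stayed alive, \<open>t\<close> is
    carried along untouched; since \<open>v (i + m)\<close> is no shorter than
    \<open>v i = s @ t\<close>, the image of \<open>s\<close> again has at least \<open>L\<close>
    letters.\<close>
  have s_alive: "L \<le> length ((?st ^^ m) s)" for m
  proof (induction m rule: less_induct)
    case (less m)
    then have "v (i + m) = (?st ^^ m) s @ t"
      unfolding v_add vi by (rule prefix_step_append)
    moreover have "length (v i) \<le> length (v (i + m))" using i(1) by (auto simp: R_def)
    ultimately show ?case using vi s by simp
  qed
  define u where "u = drop L ((?st ^^ (j - i)) s)"
  have "v j = (?st ^^ (j - i)) s @ t"
    using v_add[of "j - i"] prefix_step_append[OF s_alive, of "j - i" t] j(1) vi by simp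
  then have "take L ((?st ^^ (j - i)) s) = s" using j(2) s_alive[of "j - i"] by (simp add: s_def)
  then have "(?st ^^ (j - i)) s = s @ u" unfolding u_def by (metis append_take_drop_id)
  then have "(f ^^ (j - i)) (s \<frown> w) = (s @ u) \<frown> w" for w
    using prefix_step_run[OF f s_alive, where w = w] by metis
  moreover have "(f ^^ i) y = s \<frown> t \<frown> suffix l y"
    using prefix_step_run[OF f, of i "prefix l y" "suffix l y"] alive vi by (simp add: v_def)
  moreover have "j - i > 0" using j(1) by simp
  ultimately show ?thesis using s by blast
qed

section \<open>Powers that append or delete a word\<close>

lemma concat_replicate_comm: "u @ concat (replicate k u) = concat (replicate k u) @ u"
  by (induction k) auto

lemma funpow_attract:
  assumes "\<And>w. (f ^^ m) (s \<frown> w) = (s @ u) \<frown> w"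
  shows "(f ^^ (m * k)) (s \<frown> w) = (s @ concat (replicate k u)) \<frown> w"
proof (induction k arbitrary: w)
  case (Suc k)
  have "(f ^^ (m * Suc k)) (s \<frown> w) = (f ^^ (m * k)) (s \<frown> u \<frown> w)"
    using assms[of w] by (simp add: funpow_add add.commute[of m])
  then show ?case using Suc.IH[of "u \<frown> w"] by (simp add: concat_replicate_comm)
qed simp

lemma funpow_repel:
  assumes "\<And>w. (f ^^ m) ((e @ u) \<frown> w) = e \<frown> w"
  shows "(f ^^ (m * k)) ((e @ concat (replicate k u)) \<frown> w) = e \<frown> w"
proof (induction k arbitrary: w)
  case (Suc k)
  have "(f ^^ m) ((e @ concat (replicate (Suc k) u)) \<frown> w) = (e @ concat (replicate k u)) \<frown> w"
    using assms[of "concat (replicate k u) \<frown> w"] by simp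
  moreover have "(f ^^ (m * Suc k)) z = (f ^^ (m * k)) ((f ^^ m) z)" for z
    by (simp add: funpow_add add.commute[of m])
  ultimately show ?case using Suc.IH by simp
qed simp

lemma length_concat_replicate: "length (concat (replicate k u)) = k * length u"
  by (induction k) auto

lemma inj_funpow: "inj (f :: 'a \<Rightarrow> 'a) \<Longrightarrow> inj (f ^^ n)"
  by (induction n) (auto intro: inj_compose)

text \<open>Infinitely many return times lie in one residue class modulo \<open>m\<close>. Counted
  from one time \<open>t0\<close> of that class, a return after \<open>m * s\<close> steps forces,
  by injectivity, the point at time \<open>t0\<close> to begin with \<open>e\<close> and
  \<open>s\<close> copies of \<open>u\<close>. As \<open>s\<close> is unbounded, that point is fixed
  by \<open>f ^^ m\<close>, and hence so is \<open>y\<close>.\<close>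

lemma periodic_if_returning:
  assumes inj: "inj f" and m: "m > 0" and u: "u \<noteq> []"
    and rep: "\<And>w. (f ^^ m) ((e @ u) \<frown> w) = e \<frown> w"
    and ret: "infinite {t. \<exists>x. (f ^^ t) y = e \<frown> x}"
  shows "(f ^^ m) y = y"
proof -
  let ?T = "{t. \<exists>x. (f ^^ t) y = e \<frown> x}"
  have "finite ((\<lambda>t. t mod m) ` ?T)"
    by (rule finite_subset[of _ "{..<m}"]) (use m in auto)
  from pigeonhole_infinite[OF ret this] obtain t0
    where t0: "infinite {t \<in> ?T. t mod m = t0 mod m}" by blast
  let ?z = "(f ^^ t0) y"
  have "prefix K ((f ^^ m) ?z) = prefix K ?z" for K
  proof -
    obtain t x where t: "t > t0 + m * Suc K" "(f ^^ t) y = e \<frown> x" "t mod m = t0 mod m"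
      using t0 unfolding infinite_nat_iff_unbounded by blast
    have "t0 \<le> t" using t(1) by simp
    then have "m dvd t - t0" using mod_eq_dvd_iff_nat[of t0 t m] t(3) by metis
    then obtain s where s: "t - t0 = m * s" by (elim dvdE)
    have "m * Suc K < m * s" using t(1) s by linarith
    then have "Suc K < s" using mult_less_cancel1 by blast
    then obtain s' where s': "s = Suc s'" "K < s'" by (cases s) auto
    have "t = m * s + t0" using s \<open>t0 \<le> t\<close> by simp
    then have "(f ^^ (m * s)) ?z = e \<frown> x"
      using t(2) by (simp add: funpow_add)
    then have z: "?z = (e @ concat (replicate s u)) \<frown> x"
      using funpow_repel[OF rep, of s x] inj_funpow[OF inj, of "m * s"] by (metis injD)
    have "(f ^^ m) ?z = (e @ concat (replicate s' u)) \<frown> x"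
      using rep[of "concat (replicate s' u) \<frown> x"] z s' by simp
    moreover have "?z = (e @ concat (replicate s' u)) \<frown> u \<frown> x"
      using z s' concat_replicate_comm[of u s'] by (metis append.assoc concat.simps(2) conc_conc replicate_Suc)
    moreover have "K \<le> length (e @ concat (replicate s' u))"
    proof -
      have "s' \<le> s' * length u" using u by (cases u) auto
      then show ?thesis using s'(2) unfolding length_append length_concat_replicate by linarith
    qed
    ultimately show ?thesis by (metis prefix_conc_fst)
  qed
  then have "(f ^^ m) ?z = ?z" by (rule prefix_eqI)
  then have "(f ^^ t0) ((f ^^ m) y) = (f ^^ t0) y"
    by (metis add.commute comp_apply funpow_add)
  then show ?thesis using inj_funpow[OF inj] by (metis injD)
qed

text \<open>The words at which the prefixes of \<open>y\<close> die are shorter than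
  \<open>L\<close>, so one of them, \<open>e0\<close>, occurs for arbitrarily long prefixes. Since
  these die late, the orbit returns to the cylinder of \<open>e0\<close> infinitely often. Two
  prefixes that both die at \<open>e0\<close> differ by a word \<open>u\<close>, which is deleted
  between their times of death.\<close>

lemma dying_prefixes_repelled:
  assumes f: "depth_form f L \<sigma>" and inj: "inj f"
    and dead: "\<And>l. \<exists>n. length ((prefix_step L \<sigma> ^^ n) (prefix l y)) < L"
  shows "\<exists>e. length e < L \<and> infinite {t. \<exists>x. (f ^^ t) y = e \<frown> x} \<and>
    (\<exists>m u. m > 0 \<and> u \<noteq> [] \<and> (\<forall>w. (f ^^ m) ((e @ u) \<frown> w) = e \<frown> w))"
proof -
  let ?st = "prefix_step L \<sigma>"
  define T where "T l = (LEAST n. length ((?st ^^ n) (prefix l y)) < L)" for l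
  define e where "e l = (?st ^^ T l) (prefix l y)" for l
  have e_short: "length (e l) < L" for l
    unfolding e_def T_def using dead[of l] by (rule LeastI_ex)
  have before: "L \<le> length ((?st ^^ i) (prefix l y))" if "i < T l" for i l
    using not_less_Least[of i "\<lambda>n. length ((?st ^^ n) (prefix l y)) < L"] that
    by (auto simp: T_def)
  have run: "(f ^^ T l) (prefix l y \<frown> w) = e l \<frown> w" for l w
    unfolding e_def by (rule prefix_step_run[OF f before])
  have T_ge: "l < L + T l * L" for l
    using prefix_step_length[of "prefix l y" "T l" L \<sigma>] e_short[of l] by (simp add: e_def)
  have "finite (e ` UNIV)"
    by (rule finite_subset[OF _ finite_lists_length_le[of UNIV L]])
      (use e_short less_imp_le in auto)
  then obtain e0 where "infinite {l. e l = e0}"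
    using pigeonhole_infinite[of UNIV e] by auto
  then have inf: "\<exists>l>k. e l = e0" for k by (auto simp: infinite_nat_iff_unbounded)
  then have e0: "length e0 < L" using e_short by metis
  have "infinite {t. \<exists>x. (f ^^ t) y = e0 \<frown> x}"
    unfolding infinite_nat_iff_unbounded_le
  proof
    fix k
    obtain l where l: "l > L + k * L" "e l = e0" using inf by blast
    have "L + k * L < L + T l * L" using T_ge[of l] l by linarith
    then have "k \<le> T l" by simp
    moreover have "(f ^^ T l) y = e0 \<frown> suffix l y" using run[of l "suffix l y"] l by simp
    ultimately show "\<exists>t\<ge>k. t \<in> {t. \<exists>x. (f ^^ t) y = e0 \<frown> x}" by blast
  qed
  moreover have "\<exists>m u. m > 0 \<and> u \<noteq> [] \<and> (\<forall>w. (f ^^ m) ((e0 @ u) \<frown> w) = e0 \<frown> w)"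
  proof -
    obtain l where l: "e l = e0" using inf by blast
    obtain l' where l': "l' > l + L" "e l' = e0" using inf by blast
    define u where "u = subsequence y l l'"
    have pre: "prefix l' y = prefix l y @ u"
      using subsequence_append[of y l "l' - l"] l' by (simp add: u_def)
    have u: "u \<noteq> []" "L \<le> length u" using l' by (auto simp: u_def)
    have app: "(?st ^^ i) (prefix l' y) = (?st ^^ i) (prefix l y) @ u" if "i \<le> T l" for i
      unfolding pre by (rule prefix_step_append, rule before) (use that in simp)
    \<comment> \<open>The surplus \<open>u\<close> has at least \<open>L\<close> letters, so the
      longer prefix is still alive when the shorter one dies.\<close>
    have "L \<le> length ((?st ^^ i) (prefix l' y))" if "i \<le> T l" for i
      using app[OF that] u by simp
    then have lt: "T l < T l'"
      using e_short[of l'] unfolding e_def by (metis not_less)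
    have "(f ^^ (T l' - T l)) ((e0 @ u) \<frown> w) = e0 \<frown> w" for w
    proof -
      have "(f ^^ (T l' - T l)) ((e0 @ u) \<frown> w) = (f ^^ (T l' - T l)) ((f ^^ T l) (prefix l y \<frown> u \<frown> w))"
        using run[of l "u \<frown> w"] l by simp
      also have "\<dots> = (f ^^ (T l' - T l + T l)) (prefix l y \<frown> u \<frown> w)"
        by (simp add: funpow_add)
      also have "\<dots> = (f ^^ T l') (prefix l' y \<frown> w)" using lt pre by simp
      finally show ?thesis using run[of l' w] l' by simp
    qed
    then show ?thesis using u lt by (meson zero_less_diff)
  qed
  ultimately show ?thesis using e0 by blast
qed

text \<open>The product of the individual witnesses works; having the property at all positive
  multiples lets it survive multiplication by the other witnesses.\<close>

lemma uniform_multiple: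
  fixes P :: "'a \<Rightarrow> nat \<Rightarrow> bool"
  assumes "finite S" and "\<And>s. s \<in> S \<Longrightarrow> \<exists>m>0. \<forall>k>0. P s (m * k)"
  shows "\<exists>m>0. \<forall>s\<in>S. \<forall>k>0. P s (m * k)"
  using assms
proof (induction S)
  case (insert a S)
  then obtain m where m: "m > 0" "\<And>s k. s \<in> S \<Longrightarrow> k > 0 \<Longrightarrow> P s (m * k)" by auto
  obtain n where n: "n > 0" "\<And>k. k > 0 \<Longrightarrow> P a (n * k)" using insert.prems by blast
  have "P s (m * n * k)" if "s \<in> insert a S" "k > 0" for s k
    using that m(2)[of s "n * k"] n(2)[of "m * k"] m(1) n(1) by (auto simp: mult_ac)
  then show ?case using m(1) n(1) by (intro exI[of _ "m * n"]) auto
qed auto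

text \<open>If some prefix of \<open>y\<close> survives, \<open>y\<close> is attracted; if all die,
  \<open>y\<close> is periodic by \<open>periodic_if_returning\<close>. The words involved have
  length at most \<open>L\<close>, hence one exponent serves all of them. The word \<open>u\<close>
  may be empty, and then \<open>f ^^ M\<close> is the identity on the cylinder of
  \<open>s\<close>.\<close>

lemma uniform_period:
  assumes V: "f \<in> carrier thompson_V"
  shows "\<exists>L. \<exists>M>0. \<forall>y. (f ^^ M) y = y \<or>
    (\<exists>N s x u. length s = L \<and> (f ^^ N) y = s \<frown> x \<and> (\<forall>w. (f ^^ M) (s \<frown> w) = (s @ u) \<frown> w))"
proof -
  obtain L \<sigma> where f: "depth_form f L \<sigma>" using thompson_V_depth_form[OF V] by blast
  have inj: "inj f" using thompson_V_bij[OF V] by (rule bij_is_inj)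
  define A where "A m s \<longleftrightarrow> (\<exists>u. \<forall>w. (f ^^ m) (s \<frown> w) = (s @ u) \<frown> w)" for m s
  define R where "R m e \<longleftrightarrow> (\<exists>u. u \<noteq> [] \<and> (\<forall>w. (f ^^ m) ((e @ u) \<frown> w) = e \<frown> w))" for m e
  have A_mult: "A (m * k) s" if "A m s" for m k s
    using that funpow_attract[where f = f and m = m and s = s] unfolding A_def by metis
  have R_mult: "R (m * k) e" if R: "R m e" and k: "k > 0" for m k e
  proof -
    obtain u where "u \<noteq> []" "\<And>w. (f ^^ m) ((e @ u) \<frown> w) = e \<frown> w" using R by (auto simp: R_def)
    moreover from this have "concat (replicate k u) \<noteq> []" using k by auto
    ultimately show ?thesis unfolding R_def using funpow_repel[where f = f and m = m and e = e and u = u] by metis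
  qed
  \<comment> \<open>The implications make the claim vacuous for words that have no exponent, so
    \<open>uniform_multiple\<close> can run over all words of length at most
    \<open>L\<close>.\<close>
  have "\<exists>m>0. \<forall>k>0. ((\<exists>n>0. A n s) \<longrightarrow> A (m * k) s) \<and> ((\<exists>n>0. R n s) \<longrightarrow> R (m * k) s)" for s
  proof -
    obtain m1 where m1: "m1 > 0" "(\<exists>n>0. A n s) \<longrightarrow> A m1 s" by (metis zero_less_one)
    obtain m2 where m2: "m2 > 0" "(\<exists>n>0. R n s) \<longrightarrow> R m2 s" by (metis zero_less_one)
    have "A (m1 * m2 * k) s" if "\<exists>n>0. A n s" for k
      using A_mult[of m1 s "m2 * k"] m1(2) that by (simp add: mult_ac)
    moreover have "R (m1 * m2 * k) s" if "\<exists>n>0. R n s" "k > 0" for k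
      using R_mult[of m2 s "m1 * k"] m2(2) m1(1) that by (simp add: mult_ac)
    ultimately show ?thesis using m1 m2 by (intro exI[of _ "m1 * m2"]) auto
  qed
  moreover have "finite {s :: bool list. length s \<le> L}"
    using finite_lists_length_le[of "UNIV :: bool set" L] by simp
  ultimately have "\<exists>m>0. \<forall>s\<in>{s. length s \<le> L}. \<forall>k>0.
      ((\<exists>n>0. A n s) \<longrightarrow> A (m * k) s) \<and> ((\<exists>n>0. R n s) \<longrightarrow> R (m * k) s)"
    by (intro uniform_multiple) auto
  then   obtain M where M: "M > 0" "\<And>s k. length s \<le> L \<Longrightarrow> k > 0 \<Longrightarrow>
    ((\<exists>n>0. A n s) \<longrightarrow> A (M * k) s) \<and> ((\<exists>n>0. R n s) \<longrightarrow> R (M * k) s)" by auto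
  have M': "(\<exists>n>0. A n s) \<Longrightarrow> A M s" "(\<exists>n>0. R n s) \<Longrightarrow> R M s" if "length s \<le> L" for s
    using M(2)[OF that, of 1] by auto
  have "(f ^^ M) y = y \<or>
    (\<exists>N s x u. length s = L \<and> (f ^^ N) y = s \<frown> x \<and> (\<forall>w. (f ^^ M) (s \<frown> w) = (s @ u) \<frown> w))" for y
  proof (cases "\<exists>l. \<forall>n. L \<le> length ((prefix_step L \<sigma> ^^ n) (prefix l y))")
    case True
    then obtain N s x m u where s: "length s = L" "(f ^^ N) y = s \<frown> x" "m > 0"
      "\<forall>w. (f ^^ m) (s \<frown> w) = (s @ u) \<frown> w"
      using surviving_prefix_attracted[OF f] by meson
    then have "A M s" using M'(1)[of s] unfolding A_def by auto
    then show ?thesis using s(1,2) unfolding A_def by blast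
  next
    case False
    then have "\<exists>n. length ((prefix_step L \<sigma> ^^ n) (prefix l y)) < L" for l
      by (meson not_less)
    from dying_prefixes_repelled[OF f inj this]
    obtain e where e: "length e < L" "infinite {t. \<exists>x. (f ^^ t) y = e \<frown> x}" "\<exists>n>0. R n e"
      unfolding R_def by auto
    then obtain u where "u \<noteq> []" "\<And>w. (f ^^ M) ((e @ u) \<frown> w) = e \<frown> w"
      using M'(2)[of e] by (auto simp: R_def)
    then show ?thesis using periodic_if_returning[OF inj M(1)] e(2) by blast
  qed
  then show ?thesis using M(1) by blast
qed

section \<open>Germs at a fixed point\<close>

text \<open>Up to sign this is the base 2 logarithm of the local scaling factor: a cylinder of
  measure \<open>2^-l\<close> goes to one of measure \<open>2^-m\<close>.\<close>

definition germ :: "(bool word \<Rightarrow> bool word) \<Rightarrow> bool word \<Rightarrow> int \<Rightarrow> bool"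
  where "germ f y d \<longleftrightarrow> (\<exists>l m. local_form f y l m \<and> int m - int l = d)"

definition locally_trivial :: "(bool word \<Rightarrow> bool word) \<Rightarrow> bool word \<Rightarrow> bool"
  where "locally_trivial f y \<longleftrightarrow> (\<exists>l. \<forall>x. prefix l x = prefix l y \<longrightarrow> f x = x)"

lemma germ_exists: "f \<in> carrier thompson_V \<Longrightarrow> \<exists>d. germ f y d"
  using thompson_V_local_form unfolding germ_def by blast

lemma germ_comp:
  assumes "germ g y d" "germ f (g y) e"
  shows "germ (f \<circ> g) y (d + e)"
proof -
  obtain l m l' m' where lm: "local_form g y l m" "int m - int l = d"
    "local_form f (g y) l' m'" "int m' - int l' = e" using assms unfolding germ_def by blast
  \<comment> \<open>Both replacements are lengthened until the middle word has the common length
    \<open>m + l'\<close>.\<close>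
  have "local_form g y (l + l') (m + l')" by (rule local_form_shift) (rule lm)
  moreover have "local_form f (g y) (m + l') (m' + m)"
    using local_form_shift[OF lm(3), of m] by (simp add: add.commute)
  ultimately have "local_form (f \<circ> g) y (l + l') (m' + m)" by (rule local_form_comp)
  then show ?thesis unfolding germ_def using lm(2,4) by (intro exI conjI) auto
qed

lemma germ_inverse:
  assumes "germ f y d" "\<And>x. g (f x) = x"
  shows "germ g (f y) (- d)"
  using local_form_inverse[of f y _ _ g, OF _ assms(2)] assms(1) unfolding germ_def by fastforce

text \<open>Two prefixes of equal length of the same point coincide, so the prefix is replaced by
  itself.\<close>

lemma germ_zero_trivial:
  assumes "germ f y 0" "f y = y"
  shows "locally_trivial f y"
proof -
  obtain l where "local_form f y l l" using assms(1) unfolding germ_def by auto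
  then have "f x = x" if "prefix l x = prefix l y" for x
    using local_formD[of f y l l x] that assms(2) by (metis prefix_eq_conc)
  then show ?thesis unfolding locally_trivial_def by blast
qed

text \<open>An element that commutes with \<open>f\<close> conjugates the germ of \<open>f\<close>
  at \<open>y\<close> to its germ at \<open>h y\<close>.\<close>

lemma locally_trivial_transport:
  assumes h: "h \<in> carrier thompson_V" and comm: "\<And>x. f (h x) = h (f x)"
    and tr: "locally_trivial f (h y)"
  shows "locally_trivial f y"
proof -
  obtain l where l: "\<And>x. prefix l x = prefix l (h y) \<Longrightarrow> f x = x"
    using tr unfolding locally_trivial_def by blast
  obtain l' where l': "\<And>x. prefix l' x = prefix l' y \<Longrightarrow> prefix l (h x) = prefix l (h y)"
    using thompson_V_continuous[OF h] by blast
  have "f x = x" if "prefix l' x = prefix l' y" for x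
    using l[OF l'[OF that]] comm thompson_V_bij[OF h] by (metis bij_is_inj injD)
  then show ?thesis unfolding locally_trivial_def by blast
qed

section \<open>Neighbourhoods of a finite set\<close>

definition near :: "bool word set \<Rightarrow> nat \<Rightarrow> bool word \<Rightarrow> bool"
  where "near F k y \<longleftrightarrow> (\<exists>q\<in>F. prefix k y = prefix k q)"

lemma near_finite:
  assumes "finite F" "\<And>p. p \<in> F \<Longrightarrow> \<exists>l. \<forall>x. prefix l x = prefix l p \<longrightarrow> Q x"
  shows "\<exists>k. \<forall>y. near F k y \<longrightarrow> Q y"
proof -
  obtain l where l: "\<And>p x. p \<in> F \<Longrightarrow> prefix (l p) x = prefix (l p) p \<Longrightarrow> Q x"
    using assms(2) by metis
  \<comment> \<open>The longest of the finitely many cylinders' prefixes decides; if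
    \<open>F\<close> is empty, no point is near it.\<close>
  have "Q y" if y: "near F (Max (l ` F)) y" for y
  proof -
    obtain p where p: "p \<in> F" "prefix (Max (l ` F)) y = prefix (Max (l ` F)) p"
      using y unfolding near_def by blast
    then have "l p \<le> Max (l ` F)" using assms(1) by simp
    then show ?thesis using l[OF p(1)] prefix_le_eq[OF p(2)] by blast
  qed
  then show ?thesis by blast
qed

lemma near_continuous:
  assumes "finite F" "f \<in> carrier thompson_V" "\<And>p. p \<in> F \<Longrightarrow> f p = p"
  shows "\<exists>l. \<forall>y. near F l y \<longrightarrow> near F k (f y)"
proof (rule near_finite[OF assms(1)])
  fix p assume "p \<in> F"
  then show "\<exists>l. \<forall>x. prefix l x = prefix l p \<longrightarrow> near F k (f x)"
    using thompson_V_continuous[OF assms(2), of p k] assms(3) unfolding near_def by metis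
qed

text \<open>For an element of \<open>V\<close> these are the fixed points with nonzero germ, that
  is, the attracting and the repelling ones.\<close>

definition wandering_fixpoints :: "(bool word \<Rightarrow> bool word) \<Rightarrow> bool word set"
  where "wandering_fixpoints f = {p. f p = p \<and> \<not> locally_trivial f p}"

text \<open>Every point has a cylinder that contains at most one of them, and by compactness
  finitely many such cylinders cover the space.\<close>

lemma finite_wandering_fixpoints:
  assumes V: "f \<in> carrier thompson_V"
  shows "finite (wandering_fixpoints f)"
proof -
  let ?F = "wandering_fixpoints f"
  define P where "P v \<longleftrightarrow> (\<forall>p\<in>?F. \<forall>q\<in>?F.
    prefix (length v) p = v \<longrightarrow> prefix (length v) q = v \<longrightarrow> p = q)" for v
  have "\<exists>l. \<forall>v. length v = l \<longrightarrow> P v"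
  proof (rule fan)
    fix v u assume P: "P v"
    have "prefix (length v) p = v" if "prefix (length (v @ u)) p = v @ u" for p :: "bool word"
      using arg_cong[OF that, of "take (length v)"] by simp
    then show "P (v @ u)" using P unfolding P_def by blast
  next
    fix y
    obtain l m where lm: "local_form f y l m" using thompson_V_local_form[OF V] by blast
    consider "f y \<noteq> y" | "l = m" "f y = y" | "l < m" "f y = y" | "m < l" "f y = y"
      by linarith
    then show "\<exists>l. P (prefix l y)"
    proof cases
      case 1
      then obtain k where k: "prefix k (f y) \<noteq> prefix k y" using prefix_eqI by blast
      obtain l where l: "\<And>x. prefix l x = prefix l y \<Longrightarrow> prefix k (f x) = prefix k (f y)"
        using thompson_V_continuous[OF V] by blast
      have "p \<notin> ?F" if "prefix (max k l) p = prefix (max k l) y" for p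
        using l[of p] k prefix_le_eq[OF that, of k] prefix_le_eq[OF that, of l]
        by (auto simp: wandering_fixpoints_def)
      then show ?thesis unfolding P_def by (intro exI[of _ "max k l"]) auto
    next
      case 2
      have fx: "f x = x" if "prefix l x = prefix l y" for x
        using local_formD[OF lm that] 2 prefix_eq_conc[OF that] by simp
      then have "locally_trivial f p" if "prefix l p = prefix l y" for p
        using that unfolding locally_trivial_def by metis
      then have "p \<notin> ?F" if "prefix l p = prefix l y" for p
        using that by (simp add: wandering_fixpoints_def)
      then show ?thesis unfolding P_def by (intro exI[of _ l]) auto
    next
      case 3
      \<comment> \<open>Contracting case: beyond position \<open>m\<close>, letter \<open>i\<close>
        of a fixed point equals its earlier letter \<open>i - (m - l)\<close>, so the first
        \<open>m\<close> letters determine it.\<close>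
      have "p = q" if pq: "p \<in> ?F" "q \<in> ?F" "prefix l p = prefix l y" "prefix l q = prefix l y" for p q
      proof
        fix i
        have p: "p = prefix m y \<frown> suffix l p" and q: "q = prefix m y \<frown> suffix l q"
          using local_formD[OF lm] pq 3 by (auto simp: wandering_fixpoints_def)
        show "p i = q i"
        proof (induction i rule: less_induct)
          case (less i)
          show ?case
          proof (cases "i < m")
            case True
            then show ?thesis using arg_cong[OF p, of "\<lambda>x. x i"] arg_cong[OF q, of "\<lambda>x. x i"] by simp
          next
            case False
            then have "p i = p (l + (i - m))" "q i = q (l + (i - m))"
              using arg_cong[OF p, of "\<lambda>x. x i"] arg_cong[OF q, of "\<lambda>x. x i"] by simp_all
            then show ?thesis using less.IH[of "l + (i - m)"] False 3 by simp
          qed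
        qed
      qed
      then show ?thesis unfolding P_def by (intro exI[of _ l]) auto
    next
      case 4
      \<comment> \<open>Expanding case: the fixed point equation, read at position
        \<open>i - l + m\<close>, expresses letter \<open>i\<close> by that earlier letter, so the
        first \<open>l\<close> letters determine the point.\<close>
      have "p = q" if pq: "p \<in> ?F" "q \<in> ?F" "prefix l p = prefix l y" "prefix l q = prefix l y" for p q
      proof
        fix i
        have p: "p = prefix m y \<frown> suffix l p" and q: "q = prefix m y \<frown> suffix l q"
          using local_formD[OF lm] pq 4 by (auto simp: wandering_fixpoints_def)
        show "p i = q i"
        proof (induction i rule: less_induct)
          case (less i)
          show ?case
          proof (cases "i < l")
            case True
            have "prefix l p ! i = prefix l q ! i" using pq by simp
            then show ?thesis using True by simp
          next
            case False
            then have "p (i - l + m) = p i" "q (i - l + m) = q i"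
              using arg_cong[OF p, of "\<lambda>x. x (i - l + m)"] arg_cong[OF q, of "\<lambda>x. x (i - l + m)"]
              by simp_all
            then show ?thesis using less.IH[of "i - l + m"] False 4 by simp
          qed
        qed
      qed
      then show ?thesis unfolding P_def by (intro exI[of _ l]) auto
    qed
  qed
  then obtain l where l: "\<And>v. length v = l \<Longrightarrow> P v" by blast
  have "inj_on (prefix l) ?F"
    using l[of "prefix l _"] unfolding P_def inj_on_def by simp
  moreover have "finite (prefix l ` ?F)"
    by (rule finite_subset[OF _ finite_lists_length_le[of "UNIV :: bool set" l]]) auto
  ultimately show ?thesis using finite_imageD by blast
qed

section \<open>Attracting fixed points\<close>

lemma attractor_fixed:
  assumes "\<And>w. A (s \<frown> w) = (s @ u) \<frown> w" "u \<noteq> []"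
  shows "A (s \<frown> u\<^sup>\<omega>) = s \<frown> u\<^sup>\<omega>"
  using assms(1)[of "u\<^sup>\<omega>"] assms(2) iter_unroll[of u] by (metis conc_conc length_greater_0_conv)

text \<open>Each application inserts one more copy of the nonempty word \<open>u\<close> behind
  \<open>s\<close>, so \<open>n\<close> of them secure at least \<open>n\<close> letters of the
  limit.\<close>

lemma attracted_prefix:
  assumes A: "\<And>w. A (s \<frown> w) = (s @ u) \<frown> w" and u: "u \<noteq> []" and n: "k \<le> n"
  shows "prefix k ((A ^^ n) (s \<frown> w)) = prefix k (s \<frown> u\<^sup>\<omega>)"
proof -
  have A': "(A ^^ n) (s \<frown> w) = (s @ concat (replicate n u)) \<frown> w" for w
    using funpow_attract[where f = A and m = 1 and s = s and u = u and k = n and w = w] A by simp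
  have fix_lim: "A (s \<frown> u\<^sup>\<omega>) = s \<frown> u\<^sup>\<omega>" by (rule attractor_fixed[of A, OF A u])
  have "(A ^^ n) (s \<frown> u\<^sup>\<omega>) = s \<frown> u\<^sup>\<omega>" by (induction n) (simp_all add: fix_lim del: conc_conc)
  then have lim: "s \<frown> u\<^sup>\<omega> = (s @ concat (replicate n u)) \<frown> u\<^sup>\<omega>" using A'[of "u\<^sup>\<omega>"] by metis
  have "n \<le> n * length u" using u by (cases u) auto
  then have "k \<le> length (s @ concat (replicate n u))"
    unfolding length_append length_concat_replicate using n by linarith
  then show ?thesis unfolding A' by (subst lim) (simp only: prefix_conc_fst)
qed

text \<open>Every fixed point in the cylinder of \<open>s\<close> is the limit
  \<open>s \<frown> u\<^sup>\<omega>\<close>, while a neighbourhood fixed pointwise would contain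
  others.\<close>

lemma attractor_wandering:
  assumes A: "\<And>w. A (s \<frown> w) = (s @ u) \<frown> w" and u: "u \<noteq> []"
  shows "s \<frown> u\<^sup>\<omega> \<in> wandering_fixpoints A"
proof -
  let ?q = "s \<frown> u\<^sup>\<omega>"
  have uniq: "x = ?q" if fixed: "A x = x" and x: "x = s \<frown> w" for x w
  proof (rule prefix_eqI)
    fix k
    have "(A ^^ k) x = x" by (induction k) (simp_all add: fixed)
    then show "prefix k x = prefix k ?q" using attracted_prefix[of A, OF A u order_refl] x by metis
  qed
  have "\<not> locally_trivial A ?q"
  proof
    assume "locally_trivial A ?q"
    then obtain l where l: "\<And>x. prefix l x = prefix l ?q \<Longrightarrow> A x = x"
      unfolding locally_trivial_def by blast
    define n where "n = max l (length s)"
    \<comment> \<open>This point agrees with \<open>?q\<close> in the first \<open>n\<close> letters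
      and differs from it in letter \<open>n\<close>.\<close>
    define x where "x = prefix n ?q \<frown> (\<lambda>_. \<not> ?q n)"
    have xn: "prefix n x = prefix n ?q" unfolding x_def by simp
    have "A x = x" using l prefix_le_eq[OF xn, of l] by (simp add: n_def)
    moreover have "prefix (length s) x = s" using prefix_le_eq[OF xn, of "length s"] by (simp add: n_def)
    then have "x = s \<frown> suffix (length s) x" by (metis prefix_suffix)
    ultimately have "x = ?q" by (rule uniq)
    moreover have "x n = (\<not> ?q n)" by (simp add: x_def)
    ultimately show False by metis
  qed
  then show ?thesis using attractor_fixed[of A, OF A u] by (simp add: wandering_fixpoints_def)
qed

section \<open>Actions of the free abelian group of rank two\<close>

text \<open>A homomorphism from \<open>Z^2\<close> to \<open>V\<close>, possibly with a kernel;
  rescaled actions are instances too.\<close>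

locale V_action =
  fixes act :: "int \<Rightarrow> int \<Rightarrow> bool word \<Rightarrow> bool word"
  assumes act_V: "act i j \<in> carrier thompson_V"
    and act_zero: "act 0 0 = id"
    and act_add: "act (i + i') (j + j') = act i j \<circ> act i' j'"
begin

lemma act_act: "act i j (act i' j' y) = act (i + i') (j + j') y"
  by (simp add: act_add)

lemma act_commute: "act i j (act i' j' y) = act i' j' (act i j y)"
  by (simp add: act_act add.commute)

lemma act_inverse: "act (- i) (- j) (act i j y) = y"
  by (simp add: act_act act_zero)

lemma act_eq_iff: "act i j x = act i j y \<longleftrightarrow> x = y"
  by (metis act_inverse)

lemma act_funpow: "act i j ^^ n = act (int n * i) (int n * j)"
  by (induction n) (simp_all add: act_zero act_add[symmetric] ring_distribs)

lemma act_fixed_nat: "act i j q = q \<Longrightarrow> act (int n * i) (int n * j) q = q"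
  by (induction n) (simp_all add: act_zero ring_distribs act_add)

lemma act_fixed_neg: "act i j q = q \<Longrightarrow> act (- i) (- j) q = q"
  by (metis act_inverse)

lemma act_fixed_int: "act i j q = q \<Longrightarrow> act (k * i) (k * j) q = q"
  using act_fixed_nat[of i j q] act_fixed_neg[of "int _ * i" "int _ * j" q]
  by (cases k rule: int_cases2) auto

lemma germ_act_nat:
  assumes "act i j q = q" "germ (act i j) q d"
  shows "germ (act (int n * i) (int n * j)) q (int n * d)"
proof (induction n)
  case 0
  then show ?case by (auto simp: act_zero germ_def local_form_def intro!: exI[of _ 0])
next
  case (Suc n)
  have "germ (act (int n * i) (int n * j) \<circ> act i j) q (d + int n * d)"
    by (rule germ_comp) (use assms Suc in simp_all)
  then show ?case by (simp add: ring_distribs act_add[symmetric] add.commute)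
qed

lemma germ_act_int:
  assumes "act i j q = q" "germ (act i j) q d"
  shows "germ (act (k * i) (k * j)) q (k * d)"
proof (cases k rule: int_cases2)
  case (nonneg n)
  then show ?thesis using germ_act_nat[OF assms] by simp
next
  case (nonpos n)
  have "germ (act (- (int n * i)) (- (int n * j))) (act (int n * i) (int n * j) q) (- (int n * d))"
    by (rule germ_inverse[OF germ_act_nat[OF assms]]) (rule act_inverse)
  then show ?thesis using nonpos act_fixed_nat[OF assms(1)] by simp
qed

text \<open>
  A point that is not periodic under the first generator is attracted to some fixed point \<open>q\<close>
  of a power of it; by pigeonhole some element with nonzero second coordinate fixes \<open>q\<close> as well,
  and since germs at \<open>q\<close> are integers, a nontrivial combination of both is trivial near \<open>q\<close>.
\<close>

lemma nontrivial_stabilizer: "\<exists>i j. (i, j) \<noteq> (0, 0) \<and> act i j y = y"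
proof -
  obtain L M where M: "M > 0" and per: "\<And>y. (act 1 0 ^^ M) y = y \<or>
    (\<exists>N s x u. length s = L \<and> (act 1 0 ^^ N) y = s \<frown> x \<and> (\<forall>w. (act 1 0 ^^ M) (s \<frown> w) = (s @ u) \<frown> w))"
    using uniform_period[OF act_V[of 1 0]] by blast
  define A where "A = act (int M) 0"
  show ?thesis
  proof (cases "A y = y")
    case True
    then show ?thesis using M by (intro exI[of _ "int M"] exI[of _ 0]) (simp add: A_def)
  next
    case False
    \<comment> \<open>None of the points \<open>act 0 j y\<close> is fixed by \<open>A\<close>, so
      each of them is attracted, with words \<open>s j\<close> of one common length
      \<open>L\<close>.\<close>
    have "A (act 0 (int j) y) \<noteq> act 0 (int j) y" for j
      using False by (simp add: A_def act_commute[of "int M"] act_eq_iff)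
    then have "\<exists>N s x u. length s = L \<and> act (int N) (int j) y = s \<frown> x \<and> (\<forall>w. A (s \<frown> w) = (s @ u) \<frown> w)" for j
      using per[of "act 0 (int j) y"] by (simp add: act_funpow A_def act_act)
    then obtain N s x u where s: "\<And>j. length (s j) = L"
      and x: "\<And>j. act (int (N j)) (int j) y = s j \<frown> x j"
      and u: "\<And>j w. A (s j \<frown> w) = (s j @ u j) \<frown> w" by metis
    have "finite (range s)"
      by (rule finite_subset[OF _ finite_lists_length_le[of "UNIV :: bool set" L]]) (use s in auto)
    then obtain j j' where j: "j \<noteq> j'" "s j = s j'" by (metis finite_imageD infinite_UNIV_nat injI)
    define z where "z = act (int (N j)) (int j) y"
    define z' where "z' = act (int (N j')) (int j') y"
    define g1 where "g1 = int (N j') - int (N j)"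
    define g2 where "g2 = int j' - int j"
    have g: "act g1 g2 z = z'" by (simp add: g1_def g2_def z_def z'_def act_act)
    have uj: "u j \<noteq> []"
    proof
      assume "u j = []"
      then have "A z = z" using u[of j "x j"] x[of j] by (simp add: z_def)
      then show False using False by (simp add: A_def z_def act_commute[of "int M"] act_eq_iff)
    qed
    define q where "q = s j \<frown> (u j)\<^sup>\<omega>"
    have near: "prefix k ((A ^^ n) z) = prefix k q" "prefix k ((A ^^ n) z') = prefix k q" if "k \<le> n" for k n
      using attracted_prefix[of A, OF u uj that] x[of j] x[of j'] j
      by (simp_all add: z_def z'_def q_def)
    have Aq: "A q = q" unfolding q_def by (rule attractor_fixed[of A, OF u uj])
    have An: "(A ^^ n) (act a b x) = act a b ((A ^^ n) x)" for n a b x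
      by (simp add: A_def act_funpow act_commute[of _ _ a])
    \<comment> \<open>Both \<open>z\<close> and its image \<open>z'\<close> converge to
      \<open>q\<close> under \<open>A\<close>, and \<open>act g1 g2\<close> is continuous and
      commutes with \<open>A\<close>.\<close>
    have gq: "act g1 g2 q = q"
    proof (rule prefix_eqI)
      fix k
      obtain l where l: "\<And>x. prefix l x = prefix l q \<Longrightarrow> prefix k (act g1 g2 x) = prefix k (act g1 g2 q)"
        using thompson_V_continuous[OF act_V] by blast
      let ?n = "max k l"
      have "prefix k (act g1 g2 q) = prefix k (act g1 g2 ((A ^^ ?n) z))"
        by (rule l[OF near(1), symmetric]) simp
      also have "\<dots> = prefix k ((A ^^ ?n) z')" by (simp only: An[symmetric] g)
      finally show "prefix k (act g1 g2 q) = prefix k q" using near(2)[of k ?n] by simp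
    qed
    have "prefix (length (s j @ u j)) (A q) = s j @ u j"
      using u[of j "(u j)\<^sup>\<omega>"] unfolding q_def by (metis prefix_conc_length)
    moreover have "prefix (length (s j)) q = s j" unfolding q_def by (rule prefix_conc_length)
    ultimately have "local_form A q (length (s j)) (length (s j @ u j))"
      using u[of j] unfolding local_form_def by metis
    then have germA: "germ (act (int M) 0) q (int (length (u j)))"
      unfolding germ_def A_def by fastforce
    obtain d where d: "germ (act g1 g2) q d" using germ_exists[OF act_V] by blast
    let ?r = "int (length (u j))"
    \<comment> \<open>The combination of \<open>?r\<close> times \<open>(g1, g2)\<close> and
      \<open>- d\<close> times \<open>(M, 0)\<close> has germ \<open>?r * d - d * ?r = 0\<close> at
      \<open>q\<close>.\<close>
    define b1 where "b1 = ?r * g1 + - d * int M"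
    define b2 where "b2 = ?r * g2 + - d * 0"
    have Aq': "act (int M) 0 q = q" using Aq by (simp add: A_def)
    have "germ (act (?r * g1) (?r * g2) \<circ> act (- d * int M) (- d * 0)) q (- d * ?r + ?r * d)"
      by (rule germ_comp[OF germ_act_int[OF Aq' germA]])
        (use germ_act_int[OF gq d, of ?r] act_fixed_int[OF Aq', of "- d"] in simp)
    then have "germ (act b1 b2) q 0" by (simp only: b1_def b2_def act_add) simp
    moreover have "act b1 b2 q = q"
      using act_fixed_int[OF Aq', of "- d"] act_fixed_int[OF gq, of ?r]
      by (simp only: b1_def b2_def act_add comp_apply)
    ultimately have "locally_trivial (act b1 b2) q" by (rule germ_zero_trivial)
    then obtain l where l: "\<And>x. prefix l x = prefix l q \<Longrightarrow> act b1 b2 x = x"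
      unfolding locally_trivial_def by blast
    \<comment> \<open>\<open>(A ^^ l) z\<close> lies in the cylinder where \<open>act b1 b2\<close>
      is trivial; it is the image of \<open>y\<close> under an element that commutes with
      \<open>act b1 b2\<close>.\<close>
    from l[OF near(1)[OF order_refl]] have "act b1 b2 y = y"
      unfolding An z_def by (simp add: An[symmetric])
        (simp add: A_def act_funpow act_commute[of b1] act_eq_iff)
    moreover have "b2 \<noteq> 0" using uj j by (simp add: b2_def g2_def)
    ultimately show ?thesis by blast
  qed
qed

text \<open>This places the stabilizing element in a prescribed subgroup, below one that fixes given
  points.\<close>

lemma nontrivial_stabilizer_scaled: "\<exists>i j. (i, j) \<noteq> (0, 0) \<and> act (m * i) (n * j) y = y"
proof -
  interpret scaled: V_action "\<lambda>i j. act (m * i) (n * j)"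
    by unfold_locales (simp_all add: act_V act_zero act_add ring_distribs)
  show ?thesis by (rule scaled.nontrivial_stabilizer)
qed

text \<open>For each single point the attraction time exists by \<open>uniform_period\<close>;
  compactness makes it uniform. The neighbourhood given by \<open>k'\<close> is excluded because
  points close to a repelling point leave arbitrarily late.\<close>

lemma displacement:
  "\<exists>M>0. \<forall>k k'. \<exists>N. \<forall>n\<ge>N. \<forall>y. act (int M) 0 y = y \<or>
     near (wandering_fixpoints (act (int M) 0)) k' y \<or>
     near (wandering_fixpoints (act (int M) 0)) k (act (int n * int M) 0 y)"
proof -
  obtain L M where M: "M > 0" and per: "\<And>y. (act 1 0 ^^ M) y = y \<or>
    (\<exists>N s x u. length s = L \<and> (act 1 0 ^^ N) y = s \<frown> x \<and> (\<forall>w. (act 1 0 ^^ M) (s \<frown> w) = (s @ u) \<frown> w))"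
    using uniform_period[OF act_V[of 1 0]] by blast
  define A where "A = act (int M) 0"
  let ?F = "wandering_fixpoints A"
  have An: "(A ^^ n) (act a b x) = act a b ((A ^^ n) x)" for n a b x
    by (simp add: A_def act_funpow act_commute[of _ _ a])
  have "\<exists>N. \<forall>n\<ge>N. \<forall>y. A y = y \<or> near ?F k' y \<or> near ?F k ((A ^^ n) y)" for k k'
  proof -
    define P where "P v \<longleftrightarrow> (\<exists>N. \<forall>n\<ge>N. \<forall>y. prefix (length v) y = v \<longrightarrow>
      A y = y \<or> near ?F k' y \<or> near ?F k ((A ^^ n) y))" for v
    have "\<exists>l. \<forall>v. length v = l \<longrightarrow> P v"
    proof (rule fan)
      fix v u assume P: "P v"
      have "prefix (length v) p = v" if "prefix (length (v @ u)) p = v @ u" for p :: "bool word"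
        using arg_cong[OF that, of "take (length v)"] by simp
      then show "P (v @ u)" using P unfolding P_def by meson
    next
      fix y
      \<comment> \<open>The first two cases fall under the first two alternatives on a whole
        cylinder; only a moved point needs an attraction time.\<close>
      consider "locally_trivial A y" | "y \<in> ?F" | "A y \<noteq> y"
        by (auto simp: wandering_fixpoints_def)
      then show "\<exists>l. P (prefix l y)"
      proof cases
        case 1
        then obtain l where "\<And>x. prefix l x = prefix l y \<Longrightarrow> A x = x"
          unfolding locally_trivial_def by blast
        then show ?thesis unfolding P_def by (intro exI[of _ l]) auto
      next
        case 2
        then show ?thesis unfolding P_def near_def by (intro exI[of _ k']) auto
      next
        case 3
        then obtain N s x u where N: "act (int N) 0 y = s \<frown> x" and u: "\<And>w. A (s \<frown> w) = (s @ u) \<frown> w"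
          using per[of y] by (auto simp: act_funpow A_def)
        have "A (act (int N) 0 y) \<noteq> act (int N) 0 y"
          using 3 by (simp add: A_def act_commute[of "int M"] act_eq_iff)
        then have u0: "u \<noteq> []" using u[of x] N by auto
        let ?q = "s \<frown> u\<^sup>\<omega>"
        \<comment> \<open>\<open>N\<close> counts steps of the generator rather than of
          \<open>A\<close>, so the limit of \<open>y\<close> itself under \<open>A\<close> is
          \<open>?q\<close> moved back by \<open>N\<close> steps.\<close>
        define q where "q = act (- int N) 0 ?q"
        have q': "?q \<in> ?F" by (rule attractor_wandering[of A, OF u u0])
        have qF: "q \<in> ?F"
          using q' locally_trivial_transport[OF act_V[of "- int N" 0], of A ?q]
          by (auto simp: wandering_fixpoints_def q_def A_def act_commute[of "int M"])
        obtain l1 where l1: "\<And>x. prefix l1 x = prefix l1 ?q \<Longrightarrow>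
            prefix k (act (- int N) 0 x) = prefix k (act (- int N) 0 ?q)"
          using thompson_V_continuous[OF act_V] by blast
        obtain l where l: "\<And>x. prefix l x = prefix l y \<Longrightarrow>
            prefix (length s) (act (int N) 0 x) = prefix (length s) (act (int N) 0 y)"
          using thompson_V_continuous[OF act_V] by blast
        have "near ?F k ((A ^^ n) z)" if n: "n \<ge> l1" and z: "prefix l z = prefix l y" for n z
        proof -
          have "prefix (length s) (act (int N) 0 z) = s" using l[OF z] unfolding N by simp
          then have "act (int N) 0 z = s \<frown> suffix (length s) (act (int N) 0 z)" by (metis prefix_suffix)
          then have "prefix l1 ((A ^^ n) (act (int N) 0 z)) = prefix l1 ?q"
            using attracted_prefix[of A, OF u u0 n] by metis
          from l1[OF this] have "prefix k ((A ^^ n) z) = prefix k q"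
            unfolding q_def An[symmetric] by (simp add: act_act act_zero)
          then show ?thesis using qF unfolding near_def by blast
        qed
        then have "P (prefix l y)" unfolding P_def by (intro exI[of _ l1]) auto
        then show ?thesis by blast
      qed
    qed
    then obtain l where l: "\<And>v. length v = l \<Longrightarrow> P v" by blast
    have "\<forall>v. \<exists>N. length v = l \<longrightarrow> (\<forall>n\<ge>N. \<forall>y. prefix (length v) y = v \<longrightarrow>
      A y = y \<or> near ?F k' y \<or> near ?F k ((A ^^ n) y))" using l unfolding P_def by blast
    then obtain N where N: "\<And>v n y. length v = l \<Longrightarrow> n \<ge> N v \<Longrightarrow> prefix (length v) y = v \<Longrightarrow>
      A y = y \<or> near ?F k' y \<or> near ?F k ((A ^^ n) y)" by metis
    have fin: "finite {v :: bool list. length v = l}"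
      using finite_lists_length_eq[of "UNIV :: bool set" l] by simp
    have "A y = y \<or> near ?F k' y \<or> near ?F k ((A ^^ n) y)" if "n \<ge> Max (N ` {v. length v = l})" for n y
    proof (rule N)
      show "length (prefix l y) = l" by simp
      have "N (prefix l y) \<le> Max (N ` {v. length v = l})" using fin by (intro Max_ge) auto
      then show "N (prefix l y) \<le> n" using that by simp
    qed simp
    then show ?thesis by blast
  qed
  then show ?thesis using M by (intro exI[of _ M]) (simp add: A_def act_funpow)
qed

text \<open>The second generator commutes with \<open>act i 0\<close>, hence maps this finite set
  into itself, and by injectivity each point of it is periodic.\<close>

lemma wandering_fixpoints_fixed:
  "\<exists>M>0. \<forall>p\<in>wandering_fixpoints (act i 0). act 0 (int M) p = p"
proof -
  let ?F = "wandering_fixpoints (act i 0)"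
  have inv: "act 0 j p \<in> ?F" if "p \<in> ?F" for j p
    using that locally_trivial_transport[OF act_V[of 0 j], of "act i 0" p]
    by (auto simp: wandering_fixpoints_def act_commute[of i])
  have "\<exists>m>0. \<forall>k>0. act 0 (int (m * k)) p = p" if p: "p \<in> ?F" for p
  proof -
    have "finite (range (\<lambda>j. act 0 (int j) p))"
      by (rule finite_subset[OF _ finite_wandering_fixpoints[OF act_V[of i 0]]]) (use inv p in auto)
    then have "\<not> inj (\<lambda>j. act 0 (int j) p)" using finite_imageD infinite_UNIV_nat by blast
    then obtain j j' where j: "act 0 (int j) p = act 0 (int j') p" "j < j'"
      unfolding inj_def by (metis linorder_neqE_nat)
    have "act 0 (int j) (act 0 (int (j' - j)) p) = act 0 (int j) p"
      using j by (simp add: act_act)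
    then have "act 0 (int (j' - j)) p = p" by (simp only: act_eq_iff)
    then have "act 0 (int ((j' - j) * k)) p = p" for k
      using act_fixed_nat[of 0 "int (j' - j)" p k] by (simp add: mult.commute)
    then show ?thesis using j(2) by (intro exI[of _ "j' - j"]) simp
  qed
  then have "\<exists>m>0. \<forall>p\<in>?F. \<forall>k>0. act 0 (int (m * k)) p = p"
    by (intro uniform_multiple[where P = "\<lambda>p m. act 0 (int m) p = p"]
        finite_wandering_fixpoints[OF act_V])
  then obtain m where m: "m > 0" "\<And>p k. p \<in> ?F \<Longrightarrow> k > 0 \<Longrightarrow> act 0 (int (m * k)) p = p"
    by blast
  have "act 0 (int m) p = p" if "p \<in> ?F" for p
    using m(2)[OF that, of 1] by simp
  then show ?thesis using m(1) by blast
qed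

end

section \<open>Free products\<close>

lemma reduced_append:
  "us @ vs \<in> reduced_words G H \<longleftrightarrow> us \<in> reduced_words G H \<and> vs \<in> reduced_words G H \<and>
     (us = [] \<or> vs = [] \<or> isl (last us) \<noteq> isl (hd vs))"
  by (auto simp: reduced_words_def successively_append_iff)

lemma letter_mult_reduced:
  assumes "x # ws \<in> reduced_words G H"
  shows "letter_mult G H x ws = x # ws"
  using assms by (cases "(G, H, x, ws)" rule: letter_mult.cases) (auto simp: Cons_reduced)

text \<open>By \<open>disj\<close>, \<open>h\<close> moves the support of \<open>u\<close> off
  itself, so \<open>u\<close> and its conjugate by \<open>h\<close> have disjoint supports.\<close>

lemma disjoint_supports_commute:
  assumes "inj u" "\<And>x. h' (h x) = x" "\<And>x. h (h' x) = x"
    and disj: "\<And>y. u y = y \<or> u (h y) = h y"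
  shows "u (h' (u (h y))) = h' (u (h (u y)))"
proof (cases "u y = y")
  case True
  let ?z = "h' (u (h y))"
  have "u ?z = ?z"
  proof (cases "u (h y) = h y")
    case False
    then have "u (h ?z) \<noteq> h ?z" using assms(1,3) by (metis injD)
    then show ?thesis using disj by blast
  qed (use True assms(2) in simp)
  then show ?thesis using True by simp
next
  case False
  then have "u (u y) \<noteq> u y" using assms(1) by (metis injD)
  then show ?thesis using False disj assms(2) by metis
qed

abbreviation (input) "ZZ_Z \<equiv> free_product (integer_group \<times>\<times> integer_group) integer_group"
abbreviation (input) "ZZ_Z_words \<equiv> reduced_words (integer_group \<times>\<times> integer_group) integer_group"

section \<open>An assumed embedding and the evaluation of words\<close>

locale ZZ_Z_embedding =
  fixes \<phi> :: "(int \<times> int + int) list \<Rightarrow> bool word \<Rightarrow> bool word"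
  assumes mon: "\<phi> \<in> mon ZZ_Z thompson_V"
begin

lemma hom: "\<phi> \<in> hom ZZ_Z thompson_V"
  and inj: "inj_on \<phi> ZZ_Z_words"
  using mon by (auto simp: mon_def free_product_def)

lemma group_ZZ: "group (integer_group \<times>\<times> integer_group)"
  by (intro DirProd_group group_integer_group)

lemma phi_Nil: "\<phi> [] = id"
  using hom_one[OF hom group_free_product[OF group_ZZ group_integer_group] group_thompson_V]
  by (simp add: free_product_def thompson_V_def)

lemma phi_V: "ws \<in> ZZ_Z_words \<Longrightarrow> \<phi> ws \<in> carrier thompson_V"
  using hom by (auto simp: hom_def free_product_def)

definition act :: "int \<Rightarrow> int \<Rightarrow> bool word \<Rightarrow> bool word"
  where "act i j = \<phi> (free_product_inl (integer_group \<times>\<times> integer_group) (i, j))"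

text \<open>On reduced words this agrees with \<open>\<phi>\<close>, but it turns every
  concatenation into a composition, also where letters would merge.\<close>

definition eval_word :: "(int \<times> int + int) list \<Rightarrow> bool word \<Rightarrow> bool word"
  where "eval_word ws = foldr (\<lambda>x f. \<phi> [x] \<circ> f) ws id"

lemma eval_word_simps [simp]:
  "eval_word [] = id" "eval_word (x # ws) = \<phi> [x] \<circ> eval_word ws"
  "eval_word (us @ vs) = eval_word us \<circ> eval_word vs"
  by (auto simp: eval_word_def) (induction us, auto)

lemma phi_eq_eval_word: "ws \<in> ZZ_Z_words \<Longrightarrow> \<phi> ws = eval_word ws"
proof (induction ws)
  case (Cons x ws)
  then have r: "[x] \<in> ZZ_Z_words" "ws \<in> ZZ_Z_words" by (auto simp: Cons_reduced)
  have "[x] \<otimes>\<^bsub>ZZ_Z\<^esub> ws = x # ws" using letter_mult_reduced[OF Cons.prems] by (simp add: free_product_def)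
  then have "\<phi> (x # ws) = \<phi> [x] \<otimes>\<^bsub>thompson_V\<^esub> \<phi> ws"
    using hom_mult[OF hom, of "[x]" ws] r by (simp add: free_product_def)
  then show ?case using Cons.IH[OF r(2)] by (simp add: thompson_V_def)
qed (simp add: phi_Nil)

lemma phi_Inl: "(i, j) \<noteq> (0, 0) \<Longrightarrow> \<phi> [Inl (i, j)] = act i j"
  by (auto simp: act_def free_product_inl_def DirProd_def)

lemma Inl_reduced: "Inl (i, j) # ws \<in> ZZ_Z_words \<longleftrightarrow>
    (i, j) \<noteq> (0, 0) \<and> ws \<in> ZZ_Z_words \<and> (ws = [] \<or> \<not> isl (hd ws))"
  by (auto simp: Cons_reduced DirProd_def)

lemma Inr_reduced: "[Inr i] \<in> ZZ_Z_words \<longleftrightarrow> i \<noteq> 0"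
  by (auto simp: reduced_words_def)

sublocale V_action act
proof
  have inl: "free_product_inl (integer_group \<times>\<times> integer_group) \<in> hom (integer_group \<times>\<times> integer_group) ZZ_Z"
    by (rule free_product_inl_hom[OF group_ZZ group_integer_group])
  have comp: "\<phi> \<circ> free_product_inl (integer_group \<times>\<times> integer_group) \<in> hom (integer_group \<times>\<times> integer_group) thompson_V"
    by (rule Group.hom_compose[OF inl hom])
  show "act i j \<in> carrier thompson_V" for i j
    using comp by (auto simp: hom_def act_def DirProd_def)
  show "act 0 0 = id" by (simp add: act_def free_product_inl_def DirProd_def phi_Nil)
  show "act (i + i') (j + j') = act i j \<circ> act i' j'" for i i' j j'
    using hom_mult[OF comp, of "(i, j)" "(i', j')"] by (simp add: act_def DirProd_def thompson_V_def)
qed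

text \<open>With both ends in the factor \<open>Z\<close>, such a word can be put between letters of
  \<open>Z^2\<close> without any reduction.\<close>

definition inr_word :: "(int \<times> int + int) list \<Rightarrow> bool"
  where "inr_word ws \<longleftrightarrow> ws \<in> ZZ_Z_words \<and> ws \<noteq> [] \<and> \<not> isl (hd ws) \<and> \<not> isl (last ws)"

lemma inr_word_conj:
  assumes "inr_word us" "inr_word vs" "(i, j) \<noteq> (0, 0)"
  shows "inr_word (us @ Inl (i, j) # vs)"
  using assms by (auto simp: inr_word_def Inl_reduced reduced_append)

text \<open>Exactly the words that can follow an \<open>inr_word\<close> without reduction.\<close>

definition inl_word :: "(int \<times> int + int) list \<Rightarrow> bool"
  where "inl_word ws \<longleftrightarrow> ws \<in> ZZ_Z_words \<and> (ws = [] \<or> isl (hd ws))"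

lemma inl_word_Cons:
  assumes "inr_word us" "inl_word ws" "(i, j) \<noteq> (0, 0)"
  shows "inl_word (Inl (i, j) # us @ ws)"
  using assms by (auto simp: inr_word_def inl_word_def Inl_reduced reduced_append)

text \<open>
  If \<open>k\<close> does not fix \<open>p\<close>, then a conjugate of \<open>b\<close> by \<open>k\<close>, where \<open>b\<close> lies in the free abelian
  factor and stabilizes \<open>k p\<close>, fixes \<open>p\<close> and all points of \<open>P\<close> that \<open>k\<close> and \<open>b\<close> fix.
\<close>

lemma fixing_word:
  assumes "finite P" and M: "M > 0" "M' > 0"
    and P_fixed: "\<And>p. p \<in> P \<Longrightarrow> act (int M) 0 p = p" "\<And>p. p \<in> P \<Longrightarrow> act 0 (int M') p = p"
  shows "\<exists>k k'. inr_word k \<and> inr_word k' \<and> eval_word k \<circ> eval_word k' = id \<and>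
    eval_word k' \<circ> eval_word k = id \<and> (\<forall>p\<in>P. eval_word k p = p)"
  using assms(1,4,5)
proof (induction P rule: finite_induct)
  case empty
  have inv: "\<phi> [Inr i] \<circ> \<phi> [Inr (- i)] = id" if "i \<noteq> 0" for i
  proof -
    have "[Inr i] \<otimes>\<^bsub>ZZ_Z\<^esub> [Inr (- i)] = []" by (simp add: free_product_def)
    then have "\<phi> [Inr i] \<otimes>\<^bsub>thompson_V\<^esub> \<phi> [Inr (- i)] = \<phi> []"
      using hom_mult[OF hom, of "[Inr i]" "[Inr (- i)]"] that
      by (simp add: free_product_def Inr_reduced)
    then show ?thesis by (simp add: thompson_V_def phi_Nil)
  qed
  have "inr_word [Inr 1]" "inr_word [Inr (- 1)]" by (simp_all add: inr_word_def Inr_reduced)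
  moreover have "eval_word [Inr 1] \<circ> eval_word [Inr (- 1)] = id"
    "eval_word [Inr (- 1)] \<circ> eval_word [Inr 1] = id"
    using inv[of 1] inv[of "- 1"] by simp_all
  ultimately show ?case by blast
next
  case (insert p P)
  have "\<exists>k k'. inr_word k \<and> inr_word k' \<and> eval_word k \<circ> eval_word k' = id \<and>
    eval_word k' \<circ> eval_word k = id \<and> (\<forall>p\<in>P. eval_word k p = p)"
    by (intro insert.IH) (use insert.prems in auto)
  then obtain k k' where k: "inr_word k" "inr_word k'"
    and inv: "eval_word k \<circ> eval_word k' = id" "eval_word k' \<circ> eval_word k = id"
    and fix_P: "\<And>q. q \<in> P \<Longrightarrow> eval_word k q = q" by blast
  have inv': "eval_word k (eval_word k' x) = x" "eval_word k' (eval_word k x) = x" for x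
    using inv by (simp_all add: fun_eq_iff)
  \<comment> \<open>The stabilizer is sought among multiples of \<open>M\<close> and
    \<open>M'\<close>, since these elements fix every point of \<open>P\<close>.\<close>
  obtain i j where ij: "(i, j) \<noteq> (0, 0)" "act (int M * i) (int M' * j) (eval_word k p) = eval_word k p"
    using nontrivial_stabilizer_scaled by blast
  define a b where "a = int M * i" and "b = int M' * j"
  have ab: "(a, b) \<noteq> (0, 0)" "(- a, - b) \<noteq> (0, 0)" using ij M by (auto simp: a_def b_def)
  have "act a b q = q" if "q \<in> P" for q
  proof -
    have "act a 0 q = q" "act 0 b q = q"
      using act_fixed_int[of "int M" 0 q i] act_fixed_int[of 0 "int M'" q j] insert.prems that
      by (simp_all add: a_def b_def mult.commute)
    then show ?thesis using act_act[of a 0 0 b q] by simp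
  qed
  then have ab_fixes: "act a b (eval_word k q) = eval_word k q" if "q \<in> insert p P" for q
    using ij(2) fix_P that by (auto simp: a_def b_def)
  define c c' where "c = k' @ Inl (a, b) # k" and "c' = k' @ Inl (- a, - b) # k"
  have eval_c: "eval_word c x = eval_word k' (act a b (eval_word k x))"
    "eval_word c' x = eval_word k' (act (- a) (- b) (eval_word k x))" for x
    unfolding c_def c'_def eval_word_simps comp_apply phi_Inl[OF ab(1)] phi_Inl[OF ab(2)]
    by (rule refl)+
  have c: "inr_word c" "inr_word c'"
    unfolding c_def c'_def by (rule inr_word_conj[OF k(2,1)], rule ab)+
  have ab_inv: "act a b (act (- a) (- b) x) = x" for x by (simp add: act_act act_zero)
  have cc: "eval_word c \<circ> eval_word c' = id" "eval_word c' \<circ> eval_word c = id"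
    by (rule ext, simp only: comp_apply eval_c inv' act_inverse ab_inv id_apply)+
  have c_fixes: "\<forall>q\<in>insert p P. eval_word c q = q"
    by (intro ballI) (simp only: eval_c ab_fixes inv'(2))
  show ?case
    by (rule exI[of _ c], rule exI[of _ c'], intro conjI c cc c_fixes)
qed

section \<open>Two different reduced words with the same image\<close>

lemma no_embedding: False
proof -
  obtain M where M: "M > 0" and disp: "\<And>k k'. \<exists>N. \<forall>n\<ge>N. \<forall>y. act (int M) 0 y = y \<or>
     near (wandering_fixpoints (act (int M) 0)) k' y \<or>
     near (wandering_fixpoints (act (int M) 0)) k (act (int n * int M) 0 y)"
    using displacement by blast
  define F where "F = wandering_fixpoints (act (int M) 0)"
  have finF: "finite F" unfolding F_def by (rule finite_wandering_fixpoints[OF act_V])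
  obtain M' where M': "M' > 0" "\<And>p. p \<in> F \<Longrightarrow> act 0 (int M') p = p"
    using wandering_fixpoints_fixed[of "int M"] unfolding F_def by blast
  define a where "a e = act (e * int M) 0" for e
  have aF: "a e p = p" if "p \<in> F" for e p
    using that act_fixed_int[of "int M" 0 p e] by (simp add: a_def F_def wandering_fixpoints_def)
  have "\<exists>k k'. inr_word k \<and> inr_word k' \<and> eval_word k \<circ> eval_word k' = id \<and>
    eval_word k' \<circ> eval_word k = id \<and> (\<forall>p\<in>F. eval_word k p = p)"
    by (rule fixing_word[OF finF M M'(1) _ M'(2)]) (use aF[of _ 1] in \<open>auto simp: a_def\<close>)
  then obtain k k' where k: "inr_word k" "inr_word k'"
    and inv: "eval_word k \<circ> eval_word k' = id" "eval_word k' \<circ> eval_word k = id"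
    and kF: "\<And>p. p \<in> F \<Longrightarrow> eval_word k p = p" by blast
  define K K' where "K = eval_word k" and "K' = eval_word k'"
  have KK: "K (K' x) = x" "K' (K x) = x" for x
    using inv by (simp_all add: fun_eq_iff K_def K'_def)
  have KF: "K p = p" "K' p = p" if "p \<in> F" for p
    using kF[OF that] KK(2)[of p] by (simp_all add: K_def)
  have KV: "K \<in> carrier thompson_V" "K' \<in> carrier thompson_V"
    using k phi_V phi_eq_eval_word unfolding K_def K'_def inr_word_def by metis+
  have aV: "a e \<in> carrier thompson_V" for e by (simp add: a_def act_V)
  have aa: "a d (a e x) = a (d + e) x" for d e x by (simp add: a_def act_act ring_distribs)
  have a0: "a 0 x = x" for x by (simp add: a_def act_zero)
  define g where "g e x = K (a e (K' x))" for e x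
  have gg: "g d (g e x) = g (d + e) x" for d e x by (simp add: g_def KK aa)
  have g0: "g 0 x = x" for x by (simp add: g_def KK a0)
  define u where "u x = a 1 (g (- 1) x)" for x
  have u_inj: "inj u"
    by (rule inj_on_inverseI[of _ "\<lambda>x. g 1 (a (- 1) x)"]) (simp add: u_def aa a0 gg g0)
  \<comment> \<open>At \<open>p\<close> the germs of the four factors of \<open>u\<close> are
    integers that cancel in pairs.\<close>
  have "locally_trivial u p" if p: "p \<in> F" for p
  proof -
    obtain d e where d: "germ K' p d" and e: "germ (a 1) p e"
      using germ_exists[OF KV(2)] germ_exists[OF aV] by blast
    have d': "germ K p (- d)" using germ_inverse[OF d, of K] KK KF[OF p] by simp
    have e': "germ (a (- 1)) p (- e)" using germ_inverse[OF e, of "a (- 1)"] aa a0 aF[OF p] by simp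
    have "germ (a 1 \<circ> (K \<circ> (a (- 1) \<circ> K'))) p (d + - e + - d + e)"
      using d d' e e' KF[OF p] aF[OF p] by (intro germ_comp) simp_all
    moreover have "u = a 1 \<circ> (K \<circ> (a (- 1) \<circ> K'))" by (auto simp: u_def g_def)
    ultimately have "germ u p 0" by simp
    then show ?thesis by (rule germ_zero_trivial) (simp add: u_def g_def KF aF p)
  qed
  then have "\<exists>k. \<forall>y. near F k y \<longrightarrow> u y = y"
    by (intro near_finite[OF finF]) (simp add: locally_trivial_def)
  then obtain k1 where k1: "\<And>y. near F k1 y \<Longrightarrow> u y = y" by blast
  obtain l1 where l1: "\<And>y. near F l1 y \<Longrightarrow> near F k1 (K y)"
    using near_continuous[OF finF KV(1) KF(1)] by blast
  obtain n0 where n0: "\<And>n y. n \<ge> n0 \<Longrightarrow> a 1 y = y \<or> near F k1 y \<or> near F k1 (a (int n) y)"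
    using disp[where k = k1 and k' = k1] unfolding a_def F_def by auto
  \<comment> \<open>The bound 2 keeps the exponent \<open>1 - n\<close> in the words below
    nonzero.\<close>
  define n where "n = int (max n0 2)"
  have n: "n \<ge> 2" "\<And>y. a 1 y = y \<or> near F k1 y \<or> near F k1 (a n y)"
    unfolding n_def by (simp, rule n0) simp
  \<comment> \<open>With \<open>n\<close> fixed, \<open>l2\<close> is chosen so that
    \<open>K\<close> followed by \<open>a n\<close> takes the \<open>l2\<close>-neighbourhood of
    \<open>F\<close> into the region where \<open>u\<close> is trivial. Hence \<open>m\<close> can
    only be chosen after \<open>n\<close>.\<close>
  obtain k2 where k2: "\<And>y. near F k2 y \<Longrightarrow> near F k1 (a n y)"
    using near_continuous[OF finF aV aF] by blast
  obtain l2 where l2: "\<And>y. near F l2 y \<Longrightarrow> near F k2 (K y)"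
    using near_continuous[OF finF KV(1) KF(1)] by blast
  obtain m0 where m0: "\<And>m y. m \<ge> m0 \<Longrightarrow> a 1 y = y \<or> near F l1 y \<or> near F l2 (a (int m) y)"
    using disp[where k = l2 and k' = l1] unfolding a_def F_def by auto
  define m where "m = int (max m0 1)"
  have m: "m \<ge> 1" "\<And>y. a 1 y = y \<or> near F l1 y \<or> near F l2 (a m y)"
    unfolding m_def by (simp, rule m0) simp
  define h where "h y = a n (g m y)" for y
  define h' where "h' y = g (- m) (a (- n) y)" for y
  \<comment> \<open>Either \<open>y\<close> is already near \<open>F\<close>, or \<open>g m\<close>
    brings it near enough for \<open>a n\<close> to keep it there, or all powers of \<open>g\<close>
    fix \<open>y\<close> and the choice of \<open>n\<close> applies.\<close>
  have "u y = y \<or> u (h y) = h y" for y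
  proof -
    consider "near F k1 y" | "near F l2 (a m (K' y))" | "\<not> near F k1 y" "a 1 (K' y) = K' y"
      using m(2)[of "K' y"] l1[of "K' y"] KK by auto
    then show ?thesis
    proof cases
      case 2
      then show ?thesis using k1 k2 l2 by (simp add: h_def g_def)
    next
      case 3
      have "a e (K' y) = K' y" for e
        using act_fixed_int[of "int M" 0 "K' y" e] 3(2) by (simp add: a_def)
      then have g: "g e y = y" for e by (simp add: g_def KK)
      then show ?thesis using n(2)[of y] k1 3(1) by (auto simp: u_def h_def)
    qed (use k1 in blast)
  qed
  moreover have "h' (h x) = x" "h (h' x) = x" for x
    by (simp_all add: h_def h'_def aa a0 gg g0)
  ultimately have comm: "u (h' (u (h y))) = h' (u (h (u y)))" for y
    using disjoint_supports_commute[OF u_inj, of h' h] by blast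
  define C where "C e = k @ Inl (e * int M, 0) # k'" for e
  have C: "inr_word (C e)" if "e \<noteq> 0" for e
    using k that M unfolding C_def by (intro inr_word_conj) auto
  have C_eval: "eval_word (C e) x = g e x" if "e \<noteq> 0" for e x
    using that M by (simp add: C_def phi_Inl g_def K_def K'_def a_def)
  have A_eval: "\<phi> [Inl (e * int M, 0)] = a e" if "e \<noteq> 0" for e
    using that M by (simp add: phi_Inl a_def)
  let ?A = "\<lambda>e. Inl (e * int M, 0) :: int \<times> int + int"
  \<comment> \<open>The reduced forms of the two sides of \<open>comm\<close>, with neighbouring
    powers merged; all exponents are nonzero by the bounds on \<open>n\<close> and
    \<open>m\<close>.\<close>
  define w1 where "w1 = ?A 1 # C (- 1 - m) @ ?A (1 - n) # C (- 1) @ ?A n # C m @ []"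
  define v2 where "v2 = ?A (1 - n) # C (- 1) @ ?A n # C m @ ?A 1 # C (- 1) @ []"
  have "inl_word w1" unfolding w1_def
    by (intro inl_word_Cons C) (use n m M in \<open>auto simp: inl_word_def\<close>)
  then have w1: "w1 \<in> ZZ_Z_words" by (simp add: inl_word_def)
  have v2: "inl_word v2" unfolding v2_def
    by (intro inl_word_Cons C) (use n m M in \<open>auto simp: inl_word_def\<close>)
  have Cm: "inr_word (C (- m))" using C m by simp
  then have w2: "C (- m) @ v2 \<in> ZZ_Z_words"
    using v2 reduced_append unfolding inr_word_def inl_word_def by blast
  have "eval_word w1 y = u (h' (u (h y)))" for y
    using n(1) m(1) by (simp add: w1_def A_eval A_eval[of 1, simplified] C_eval u_def h_def h'_def aa gg)
  moreover have "eval_word (C (- m) @ v2) y = h' (u (h (u y)))" for y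
    using n(1) m(1) by (simp add: v2_def A_eval A_eval[of 1, simplified] C_eval u_def h_def h'_def aa gg)
  ultimately have "\<phi> w1 = \<phi> (C (- m) @ v2)"
    using comm phi_eq_eval_word w1 w2 by (simp add: fun_eq_iff)
  then have "w1 = C (- m) @ v2" using inj w1 w2 by (meson inj_onD)
  \<comment> \<open>One word begins in \<open>Z^2\<close> and the other in \<open>Z\<close>.\<close>
  then have "isl (hd w1) = isl (hd (C (- m)))" using Cm by (simp add: inr_word_def)
  then show False using Cm by (simp add: w1_def inr_word_def)
qed

end

theorem theorem1p2:
  shows "\<not> (\<exists>\<phi>. \<phi> \<in> mon (free_product (integer_group \<times>\<times> integer_group) integer_group) thompson_V)"
proof
  assume "\<exists>\<phi>. \<phi> \<in> mon ZZ_Z thompson_V"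
  then obtain \<phi> where "\<phi> \<in> mon ZZ_Z thompson_V" ..
  then interpret ZZ_Z_embedding \<phi> by unfold_locales
  show False by (rule no_embedding)
qed

end
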